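(* Let $(\varphi,g)$ be a $G_2$-structure on a $7$-manifold $M$ with full torsion tensor $T$, and let $\chi$ be a $3$-form such that $\tilde\varphi=\varphi+\chi$ is again a positive $3$-form, with associated metric $\tilde g$. Then the full torsion tensor $\tilde T$ of the $G_2$-structure $(\tilde\varphi,\tilde g)$ is given by $$\tilde T_a{}^{\tilde m}=\left(\frac{\det g}{\det\tilde g}\right)^{\frac12}\Big(T_a{}^m+\tfrac1{24}T_a{}^e\psi_{ebcd}\,( *\chi)^{mbcd}+\tfrac1{24}\psi^{mbcd}\nabla_a\chi_{bcd}+\tfrac1{24}\nabla_a\chi_{bcd}\,( *\chi)^{mbcd}\Big)-\tfrac12\,\delta\Gamma_a{}^e{}_b\,\tilde\varphi_e{}^{\tilde m\tilde b},$$ where $$\delta\Gamma_a{}^b{}_c=\tfrac12\left(\frac{\det g}{\det\tilde g}\right)^{\frac12}\Big(\tilde g^{\tilde b\tilde d}(\nabla_cs_{ad}+\nabla_as_{cd}-\nabla_ds_{ac})-\tfrac19\big(\delta_a^b\delta_c^e+\delta_c^b\delta_a^e-\tilde g_{ac}\tilde g^{\tilde b\tilde e}\big)\tilde g^{\tilde m\tilde n}\nabla_es_{mn}\Big)$$ and $$s_{ab}=g_{ab}+\tfrac12\chi_{mn(a}\varphi_{b)}{}^{mn}+\tfrac18\chi_{amn}\chi_{bpq}\psi^{mnpq}+\tfrac1{24}\chi_{amn}\chi_{bpq}( *\chi)^{mnpq}.$$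
   Context: A $3$-form on a $7$-manifold is positive if at each point it lies in the $GL(7,\mathbb R)$-orbit of $\varphi_0=e^{123}+e^{145}+e^{167}+e^{246}-e^{257}-e^{347}-e^{356}$ (with $e^{ijk}=e^i\wedge e^j\wedge e^k$). A positive $3$-form $\varphi$ determines a Riemannian metric $g$ and volume form by $g(u,w)\,\mathrm{vol}=\frac16(u\lrcorner\varphi)\wedge(w\lrcorner\varphi)\wedge\varphi$; the pair $(\varphi,g)$ is called a $G_2$-structure. $\psi=*\varphi$, where $*$ is the Hodge star of $g$; with these conventions $\varphi_{abc}\varphi_{mn}{}^{c}=g_{am}g_{bn}-g_{an}g_{bm}+\psi_{abmn}$. $\nabla$ is the Levi-Civita connection of $g$. The full torsion tensor $T_{ab}$ of $(\varphi,g)$ is defined by $\nabla_a\varphi_{bcd}=T_a{}^{e}\psi_{ebcd}$, equivalently $T_a{}^m=\frac1{24}(\nabla_a\varphi_{bcd})\psi^{mbcd}$. Similarly $\tilde T$ is defined by $\tilde\varphi$, $\tilde g$, $\tilde\psi=\tilde*\tilde\varphi$ and the Levi-Civita connection of $\tilde g$. Indices without tilde are raised with $g$; upper indices with a tilde have been raised with $\tilde g$. Round brackets denote symmetrization with unit weight.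
   Formalization: It is additionally assumed that φ and φ̃ induce the same orientation; otherwise the formula fails: χ = −2φ gives φ̃ = −φ, g̃ = g, T̃ = −T, while the right-hand side equals T. *)

theory Defs
  imports "HOL-Analysis.Analysis"
begin

section \<open>Smooth 7-manifolds\<close>

text \<open>
  The carrier is an abstract topology. A chart is a pair of its domain and its coordinate map.
  A tensor field on the manifold is the family of its component functions: for each chart of the
  atlas, functions of the coordinates, related on overlaps by the tensor transformation law.
  Values of component functions outside the coordinate range of the chart are irrelevant.
\<close>

type_synonym 'a chart = "'a set \<times> ('a \<Rightarrow> real^7)"

definition coords :: "'a chart \<Rightarrow> (real^7) set" where
  "coords \<kappa> = snd \<kappa> ` fst \<kappa>"

definition overlap :: "'a chart \<Rightarrow> 'a chart \<Rightarrow> (real^7) set" where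
  "overlap \<kappa> \<kappa>' = snd \<kappa> ` (fst \<kappa> \<inter> fst \<kappa>')"

definition transition :: "'a chart \<Rightarrow> 'a chart \<Rightarrow> real^7 \<Rightarrow> real^7" where
  "transition \<kappa> \<kappa>' = snd \<kappa>' \<circ> inv_into (fst \<kappa>) (snd \<kappa>)"

definition partial :: "7 \<Rightarrow> (real^7 \<Rightarrow> real) \<Rightarrow> real^7 \<Rightarrow> real" where
  "partial i f x = frechet_derivative f (at x) (axis i 1)"

primrec Ck_on :: "nat \<Rightarrow> (real^7) set \<Rightarrow> (real^7 \<Rightarrow> real) \<Rightarrow> bool" where
  "Ck_on 0 U f \<longleftrightarrow> continuous_on U f"
| "Ck_on (Suc k) U f \<longleftrightarrow> f differentiable_on U \<and> (\<forall>i. Ck_on k U (partial i f))"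

text \<open>Only used for open \<open>U\<close>.\<close>

definition smooth_on :: "(real^7) set \<Rightarrow> (real^7 \<Rightarrow> real) \<Rightarrow> bool" where
  "smooth_on U f \<longleftrightarrow> (\<forall>k. Ck_on k U f)"

definition smooth_manifold7 :: "'a topology \<Rightarrow> 'a chart set \<Rightarrow> bool" where
  "smooth_manifold7 X A \<longleftrightarrow>
     Hausdorff_space X \<and> second_countable X \<and>
     (\<Union>\<kappa>\<in>A. fst \<kappa>) = topspace X \<and>
     (\<forall>\<kappa>\<in>A. openin X (fst \<kappa>) \<and> open (coords \<kappa>) \<and>
        homeomorphic_map (subtopology X (fst \<kappa>)) (top_of_set (coords \<kappa>)) (snd \<kappa>)) \<and>
     (\<forall>\<kappa>\<in>A. \<forall>\<kappa>'\<in>A. \<forall>i. smooth_on (overlap \<kappa> \<kappa>') (\<lambda>x. transition \<kappa> \<kappa>' x $ i))"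

text \<open>\<open>jacobian \<kappa> \<kappa>' x $ a $ i\<close> is the derivative of the \<open>a\<close>-th coordinate of \<open>\<kappa>'\<close> along the
  \<open>i\<close>-th coordinate of \<open>\<kappa>\<close>.\<close>

definition jacobian :: "'a chart \<Rightarrow> 'a chart \<Rightarrow> real^7 \<Rightarrow> real^7^7" where
  "jacobian \<kappa> \<kappa>' x = (\<chi> a i. partial i (\<lambda>y. transition \<kappa> \<kappa>' y $ a) x)"


section \<open>Tensors at a point\<close>

type_synonym cov2 = "7 \<Rightarrow> 7 \<Rightarrow> real"
type_synonym cov3 = "7 \<Rightarrow> 7 \<Rightarrow> 7 \<Rightarrow> real"
type_synonym cov4 = "7 \<Rightarrow> 7 \<Rightarrow> 7 \<Rightarrow> 7 \<Rightarrow> real"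

definition alternating3 :: "cov3 \<Rightarrow> bool" where
  "alternating3 \<omega> \<longleftrightarrow> (\<forall>i j k. \<omega> i j k = - \<omega> j i k \<and> \<omega> i j k = - \<omega> i k j)"

definition pullback3 :: "real^7^7 \<Rightarrow> cov3 \<Rightarrow> cov3" where
  "pullback3 P \<omega> i j k = (\<Sum>a\<in>UNIV. \<Sum>b\<in>UNIV. \<Sum>c\<in>UNIV. P$a$i * P$b$j * P$c$k * \<omega> a b c)"

text \<open>\<open>basis3 i j k\<close> is \<open>e\<^sup>i \<and> e\<^sup>j \<and> e\<^sup>k\<close>.\<close>

definition basis3 :: "7 \<Rightarrow> 7 \<Rightarrow> 7 \<Rightarrow> cov3" where
  "basis3 i j k a b c =
     det (vector [vector [of_bool (i = a), of_bool (i = b), of_bool (i = c)],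
                  vector [of_bool (j = a), of_bool (j = b), of_bool (j = c)],
                  vector [of_bool (k = a), of_bool (k = b), of_bool (k = c)]] :: real^3^3)"

definition phi0 :: cov3 where
  "phi0 a b c = basis3 1 2 3 a b c + basis3 1 4 5 a b c + basis3 1 6 7 a b c + basis3 2 4 6 a b c
     - basis3 2 5 7 a b c - basis3 3 4 7 a b c - basis3 3 5 6 a b c"

definition positive3 :: "cov3 \<Rightarrow> bool" where
  "positive3 \<omega> \<longleftrightarrow> (\<exists>P. invertible P \<and> \<omega> = pullback3 P phi0)"

definition interior3 :: "real^7 \<Rightarrow> cov3 \<Rightarrow> cov2" where
  "interior3 u \<omega> j k = (\<Sum>i\<in>UNIV. u$i * \<omega> i j k)"

text \<open>The coefficient of \<open>\<alpha> \<and> \<beta> \<and> \<gamma>\<close> with respect to \<open>e\<^sup>1 \<and> \<dots> \<and> e\<^sup>7\<close>, for 2-forms \<open>\<alpha>\<close>, \<open>\<beta>\<close>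
  and a 3-form \<open>\<gamma>\<close>; the denominator is \<open>2! 2! 3!\<close>.\<close>

definition wedge223 :: "cov2 \<Rightarrow> cov2 \<Rightarrow> cov3 \<Rightarrow> real" where
  "wedge223 \<alpha> \<beta> \<gamma> =
     (\<Sum>\<sigma> | \<sigma> permutes (UNIV :: 7 set).
        of_int (sign \<sigma>) * \<alpha> (\<sigma> 1) (\<sigma> 2) * \<beta> (\<sigma> 3) (\<sigma> 4) * \<gamma> (\<sigma> 5) (\<sigma> 6) (\<sigma> 7)) / 24"

text \<open>Index raising with a metric \<open>G\<close>: the second index of a 2-tensor, the last two indices of a
  3-tensor, or all indices.\<close>

definition raise2 :: "real^7^7 \<Rightarrow> cov2 \<Rightarrow> cov2" where
  "raise2 G t a m = (\<Sum>b\<in>UNIV. matrix_inv G $ m $ b * t a b)"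

definition raise23 :: "real^7^7 \<Rightarrow> cov3 \<Rightarrow> cov3" where
  "raise23 G \<omega> a m n =
     (\<Sum>b\<in>UNIV. \<Sum>c\<in>UNIV. matrix_inv G $ m $ b * matrix_inv G $ n $ c * \<omega> a b c)"

definition raise123 :: "real^7^7 \<Rightarrow> cov3 \<Rightarrow> cov3" where
  "raise123 G \<omega> l m n =
     (\<Sum>a\<in>UNIV. \<Sum>b\<in>UNIV. \<Sum>c\<in>UNIV.
        matrix_inv G $ l $ a * matrix_inv G $ m $ b * matrix_inv G $ n $ c * \<omega> a b c)"

definition raise1234 :: "real^7^7 \<Rightarrow> cov4 \<Rightarrow> cov4" where
  "raise1234 G \<psi> k l m n =
     (\<Sum>a\<in>UNIV. \<Sum>b\<in>UNIV. \<Sum>c\<in>UNIV. \<Sum>d\<in>UNIV.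
        matrix_inv G $ k $ a * matrix_inv G $ l $ b * matrix_inv G $ m $ c * matrix_inv G $ n $ d
          * \<psi> a b c d)"

text \<open>The Hodge star of a 3-form, for the metric \<open>G\<close> and the volume form
  \<open>v e\<^sup>1 \<and> \<dots> \<and> e\<^sup>7\<close>: in index notation
  \<open>(*\<omega>)\<^sub>m\<^sub>b\<^sub>c\<^sub>d = 1/3! \<omega>\<^sup>i\<^sup>j\<^sup>k vol\<^sub>i\<^sub>j\<^sub>k\<^sub>m\<^sub>b\<^sub>c\<^sub>d\<close>, so that \<open>\<alpha> \<and> *\<omega> = \<langle>\<alpha>, \<omega>\<rangle> vol\<close>.\<close>

definition hodge3 :: "real^7^7 \<Rightarrow> real \<Rightarrow> cov3 \<Rightarrow> cov4" where
  "hodge3 G v \<omega> m b c d =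
     v / 6 * (\<Sum>\<sigma> | \<sigma> permutes (UNIV :: 7 set) \<and> \<sigma> 4 = m \<and> \<sigma> 5 = b \<and> \<sigma> 6 = c \<and> \<sigma> 7 = d.
        of_int (sign \<sigma>) * raise123 G \<omega> (\<sigma> 1) (\<sigma> 2) (\<sigma> 3))"

definition symmetrize2 :: "cov2 \<Rightarrow> cov2" where
  "symmetrize2 t a b = (t a b + t b a) / 2"


section \<open>Tensor fields\<close>

definition three_form :: "'a chart set \<Rightarrow> ('a chart \<Rightarrow> real^7 \<Rightarrow> cov3) \<Rightarrow> bool" where
  "three_form A \<omega> \<longleftrightarrow>
     (\<forall>\<kappa>\<in>A. (\<forall>i j k. smooth_on (coords \<kappa>) (\<lambda>x. \<omega> \<kappa> x i j k)) \<and>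
        (\<forall>x\<in>coords \<kappa>. alternating3 (\<omega> \<kappa> x))) \<and>
     (\<forall>\<kappa>\<in>A. \<forall>\<kappa>'\<in>A. \<forall>x\<in>overlap \<kappa> \<kappa>'.
        \<omega> \<kappa> x = pullback3 (jacobian \<kappa> \<kappa>' x) (\<omega> \<kappa>' (transition \<kappa> \<kappa>' x)))"

definition riemannian_metric :: "'a chart set \<Rightarrow> ('a chart \<Rightarrow> real^7 \<Rightarrow> real^7^7) \<Rightarrow> bool" where
  "riemannian_metric A g \<longleftrightarrow>
     (\<forall>\<kappa>\<in>A. (\<forall>i j. smooth_on (coords \<kappa>) (\<lambda>x. g \<kappa> x $ i $ j)) \<and>
        (\<forall>x\<in>coords \<kappa>. transpose (g \<kappa> x) = g \<kappa> x \<and>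
           (\<forall>u. u \<noteq> 0 \<longrightarrow> u \<bullet> (g \<kappa> x *v u) > 0))) \<and>
     (\<forall>\<kappa>\<in>A. \<forall>\<kappa>'\<in>A. \<forall>x\<in>overlap \<kappa> \<kappa>'.
        g \<kappa> x = transpose (jacobian \<kappa> \<kappa>' x) ** g \<kappa>' (transition \<kappa> \<kappa>' x) ** jacobian \<kappa> \<kappa>' x)"

text \<open>A 7-form is given by its coefficient \<open>v\<close> with respect to \<open>dx\<^sup>1 \<and> \<dots> \<and> dx\<^sup>7\<close>. It is a
  Riemannian volume form of \<open>g\<close>, for one of the two orientations at each point, if and only if
  \<open>v\<^sup>2 = det g\<close>. No orientation is given beforehand, so \<open>v\<close> may be negative in a chart.\<close>

definition volume_form ::
  "'a chart set \<Rightarrow> ('a chart \<Rightarrow> real^7 \<Rightarrow> real^7^7) \<Rightarrow> ('a chart \<Rightarrow> real^7 \<Rightarrow> real) \<Rightarrow> bool" where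
  "volume_form A g v \<longleftrightarrow>
     (\<forall>\<kappa>\<in>A. smooth_on (coords \<kappa>) (v \<kappa>) \<and> (\<forall>x\<in>coords \<kappa>. (v \<kappa> x)\<^sup>2 = det (g \<kappa> x))) \<and>
     (\<forall>\<kappa>\<in>A. \<forall>\<kappa>'\<in>A. \<forall>x\<in>overlap \<kappa> \<kappa>'.
        v \<kappa> x = det (jacobian \<kappa> \<kappa>' x) * v \<kappa>' (transition \<kappa> \<kappa>' x))"

text \<open>The pair \<open>(\<phi>, g)\<close> is a \<open>G\<^sub>2\<close>-structure, and \<open>v\<close> is the volume form determined by \<open>\<phi>\<close>. The
  last clause, with \<open>v\<^sup>2 = det g\<close>, determines \<open>g\<close> and \<open>v\<close> from \<open>\<phi>\<close>.\<close>

definition g2_structure ::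
  "'a chart set \<Rightarrow> ('a chart \<Rightarrow> real^7 \<Rightarrow> cov3) \<Rightarrow> ('a chart \<Rightarrow> real^7 \<Rightarrow> real^7^7)
     \<Rightarrow> ('a chart \<Rightarrow> real^7 \<Rightarrow> real) \<Rightarrow> bool" where
  "g2_structure A \<phi> g v \<longleftrightarrow>
     three_form A \<phi> \<and> riemannian_metric A g \<and> volume_form A g v \<and>
     (\<forall>\<kappa>\<in>A. \<forall>x\<in>coords \<kappa>. positive3 (\<phi> \<kappa> x) \<and>
        (\<forall>u w. (u \<bullet> (g \<kappa> x *v w)) * v \<kappa> x =
           1 / 6 * wedge223 (interior3 u (\<phi> \<kappa> x)) (interior3 w (\<phi> \<kappa> x)) (\<phi> \<kappa> x)))"

text \<open>The \<open>GL(7,\<real>)\<close>-orbit of \<open>phi0\<close> contains \<open>-phi0\<close>, so two positive 3-forms can induce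
  opposite orientations. The quotient of their volume forms is the positive square root of the
  quotient of the determinants of the metrics only if the orientations agree.\<close>

definition same_orientation ::
  "'a chart set \<Rightarrow> ('a chart \<Rightarrow> real^7 \<Rightarrow> real) \<Rightarrow> ('a chart \<Rightarrow> real^7 \<Rightarrow> real) \<Rightarrow> bool" where
  "same_orientation A v v' \<longleftrightarrow> (\<forall>\<kappa>\<in>A. \<forall>x\<in>coords \<kappa>. v \<kappa> x * v' \<kappa> x > 0)"


section \<open>Covariant derivative and torsion in a chart\<close>

text \<open>\<open>christoffel G x e a b\<close> is \<open>\<Gamma>\<^sup>e\<^sub>a\<^sub>b\<close> for the Levi-Civita connection of \<open>G\<close>.\<close>

definition christoffel :: "(real^7 \<Rightarrow> real^7^7) \<Rightarrow> real^7 \<Rightarrow> 7 \<Rightarrow> 7 \<Rightarrow> 7 \<Rightarrow> real" where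
  "christoffel G x e a b =
     1 / 2 * (\<Sum>d\<in>UNIV. matrix_inv (G x) $ e $ d *
        (partial a (\<lambda>y. G y $ d $ b) x + partial b (\<lambda>y. G y $ d $ a) x
          - partial d (\<lambda>y. G y $ a $ b) x))"

text \<open>The first index after the point is the direction of differentiation.\<close>

definition nabla2 :: "(real^7 \<Rightarrow> real^7^7) \<Rightarrow> (real^7 \<Rightarrow> cov2) \<Rightarrow> real^7 \<Rightarrow> cov3" where
  "nabla2 G t x a b c =
     partial a (\<lambda>y. t y b c) x
       - (\<Sum>e\<in>UNIV. christoffel G x e a b * t x e c)
       - (\<Sum>e\<in>UNIV. christoffel G x e a c * t x b e)"

definition nabla3 :: "(real^7 \<Rightarrow> real^7^7) \<Rightarrow> (real^7 \<Rightarrow> cov3) \<Rightarrow> real^7 \<Rightarrow> cov4" where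
  "nabla3 G \<omega> x a b c d =
     partial a (\<lambda>y. \<omega> y b c d) x
       - (\<Sum>e\<in>UNIV. christoffel G x e a b * \<omega> x e c d)
       - (\<Sum>e\<in>UNIV. christoffel G x e a c * \<omega> x b e d)
       - (\<Sum>e\<in>UNIV. christoffel G x e a d * \<omega> x b c e)"

text \<open>Levi-Civita means torsion-free and metric.\<close>

lemma partial_cong:
  assumes "open U" "x \<in> U" "\<And>y. y \<in> U \<Longrightarrow> f y = f' y"
  shows "partial i f x = partial i f' x"
proof -
  have "(f has_derivative D) (at x) \<longleftrightarrow> (f' has_derivative D) (at x)" for D
    using has_derivative_transform_within_open[OF _ assms(1,2)] assms(3) by metis
  then show ?thesis
    by (simp add: partial_def frechet_derivative_def)
qed

lemma christoffel_unique:
  assumes "open U" "x \<in> U" "invertible (G x)" and sym: "\<And>y. y \<in> U \<Longrightarrow> transpose (G y) = G y"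
  shows "(\<forall>e a b. \<Gamma> e a b = \<Gamma> e b a) \<and>
         (\<forall>a b c. partial a (\<lambda>y. G y $ b $ c) x
            - (\<Sum>e\<in>UNIV. \<Gamma> e a b * G x $ e $ c) - (\<Sum>e\<in>UNIV. \<Gamma> e a c * G x $ b $ e) = 0)
     \<longleftrightarrow> \<Gamma> = christoffel G x"
proof -
  define D where "D a b c = partial a (\<lambda>y. G y $ b $ c) x" for a b c
  define K where "K = matrix_inv (G x)"
  have s: "G y $ b $ c = G y $ c $ b" if "y \<in> U" for y b c
    proof -
    have "G y $ b $ c = transpose (G y) $ c $ b"
      by (simp add: transpose_def)
    then show ?thesis
      using sym[OF that] by simp
  qed
  have sx: "G x $ b $ c = G x $ c $ b" for b c
    using s assms(2) by blast
  have Dsym: "D a b c = D a c b" for a b c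
    unfolding D_def by (rule partial_cong[OF assms(1,2)]) (rule s)
  have "G x ** K = mat 1" "K ** G x = mat 1"
    using someI_ex[OF assms(3)[unfolded invertible_def]] unfolding K_def matrix_inv_def by auto
  then have GK: "G x *v (K *v u) = u" "K *v (G x *v u) = u" for u
    by (simp_all add: matrix_vector_mul_assoc)
  define L where "L \<Gamma> a b d = (G x *v (\<chi> e. \<Gamma> e a b)) $ d" for \<Gamma> :: "7 \<Rightarrow> 7 \<Rightarrow> 7 \<Rightarrow> real" and a b d
  have L1: "(\<Sum>e\<in>UNIV. \<Gamma> e a b * G x $ e $ c) = L \<Gamma> a b c" for \<Gamma> a b c
    unfolding L_def matrix_vector_mult_def by (simp add: sx[of _ c] mult.commute)
  have L2: "(\<Sum>e\<in>UNIV. \<Gamma> e a c * G x $ b $ e) = L \<Gamma> a c b" for \<Gamma> a b c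
    unfolding L_def matrix_vector_mult_def by (simp add: mult.commute)
  have ch: "(\<chi> e. christoffel G x e a b) = K *v (\<chi> d. (D a d b + D b d a - D d a b) / 2)" for a b
    unfolding christoffel_def matrix_vector_mult_def D_def K_def
    by (simp add: vec_eq_iff sum_distrib_left)
  have Lch: "L (christoffel G x) a b d = (D a d b + D b d a - D d a b) / 2" for a b d
    unfolding L_def ch by (simp add: GK)
  have eqI: "\<Gamma> e a b = \<Gamma>' e a' b'" if "\<And>d. L \<Gamma> a b d = L \<Gamma>' a' b' d" for \<Gamma> \<Gamma>' e a b a' b'
  proof -
    have "G x *v (\<chi> e. \<Gamma> e a b) = G x *v (\<chi> e. \<Gamma>' e a' b')"
      using that by (simp add: L_def vec_eq_iff)
    then have "K *v (G x *v (\<chi> e. \<Gamma> e a b)) = K *v (G x *v (\<chi> e. \<Gamma>' e a' b'))"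
      by (simp only:)
    then have "(\<chi> e. \<Gamma> e a b) = (\<chi> e. \<Gamma>' e a' b')"
      by (simp only: GK)
    then show ?thesis by (simp add: vec_eq_iff)
  qed
  show ?thesis
    unfolding D_def[symmetric] L1 L2
  proof (intro iffI conjI allI)
    assume *: "(\<forall>e a b. \<Gamma> e a b = \<Gamma> e b a) \<and> (\<forall>a b c. D a b c - L \<Gamma> a b c - L \<Gamma> a c b = 0)"
    have Ls: "L \<Gamma> a b d = L \<Gamma> b a d" for a b d
      using * by (simp add: L_def)
    have Dl: "D a b c = L \<Gamma> a b c + L \<Gamma> a c b" for a b c
    proof -
      have "D a b c - L \<Gamma> a b c - L \<Gamma> a c b = 0"
        using * by blast
      then show ?thesis by linarith
    qed
    have "L \<Gamma> a b d = L (christoffel G x) a b d" for a b d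
    proof -
      have "D a d b + D b d a - D d a b = 2 * L \<Gamma> a b d"
        unfolding Dl Ls[of d a] Ls[of b a d] Ls[of d b a] by simp
      then show ?thesis
        by (simp only: Lch)
    qed
    then show "\<Gamma> = christoffel G x"
      by (intro ext) (rule eqI)
  next
    fix e a b
    assume *: "\<Gamma> = christoffel G x"
    show "\<Gamma> e a b = \<Gamma> e b a"
      unfolding * by (rule eqI) (simp add: Lch Dsym[of _ a b])
  next
    fix a b c
    assume *: "\<Gamma> = christoffel G x"
    show "D a b c - L \<Gamma> a b c - L \<Gamma> a c b = 0"
      unfolding * Lch using Dsym[of a b c] Dsym[of b a c] Dsym[of c a b] by (simp add: field_simps)
  qed
qed

text \<open>\<open>T\<close> has both indices down; the defining equation is
  \<open>\<nabla>\<^sub>a \<phi>\<^sub>b\<^sub>c\<^sub>d = T\<^sub>a\<^sup>e \<psi>\<^sub>e\<^sub>b\<^sub>c\<^sub>d\<close> with \<open>\<psi> = *\<phi>\<close>.\<close>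

definition full_torsion ::
  "'a chart set \<Rightarrow> ('a chart \<Rightarrow> real^7 \<Rightarrow> cov3) \<Rightarrow> ('a chart \<Rightarrow> real^7 \<Rightarrow> real^7^7)
     \<Rightarrow> ('a chart \<Rightarrow> real^7 \<Rightarrow> real) \<Rightarrow> ('a chart \<Rightarrow> real^7 \<Rightarrow> cov2) \<Rightarrow> bool" where
  "full_torsion A \<phi> g v T \<longleftrightarrow>
     (\<forall>\<kappa>\<in>A. \<forall>x\<in>coords \<kappa>. \<forall>a b c d.
        nabla3 (g \<kappa>) (\<phi> \<kappa>) x a b c d =
          (\<Sum>e\<in>UNIV. raise2 (g \<kappa> x) (T \<kappa> x) a e * hodge3 (g \<kappa> x) (v \<kappa> x) (\<phi> \<kappa> x) e b c d))"


section \<open>Deformation of a \<open>G\<^sub>2\<close>-structure\<close>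

text \<open>Here \<open>G\<close>, \<open>v\<close>, \<open>\<phi>\<close>, \<open>chi\<close> are the values at a point of the metric, the coefficient of the
  volume form, the original 3-form and its increment.\<close>

definition s_tensor :: "real^7^7 \<Rightarrow> real \<Rightarrow> cov3 \<Rightarrow> cov3 \<Rightarrow> cov2" where
  "s_tensor G v \<phi> chi a b =
     G $ a $ b
     + 1 / 2 * symmetrize2 (\<lambda>a b. \<Sum>m\<in>UNIV. \<Sum>n\<in>UNIV. chi m n a * raise23 G \<phi> b m n) a b
     + 1 / 8 * (\<Sum>m\<in>UNIV. \<Sum>n\<in>UNIV. \<Sum>p\<in>UNIV. \<Sum>q\<in>UNIV.
         chi a m n * chi b p q * raise1234 G (hodge3 G v \<phi>) m n p q)
     + 1 / 24 * (\<Sum>m\<in>UNIV. \<Sum>n\<in>UNIV. \<Sum>p\<in>UNIV. \<Sum>q\<in>UNIV.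
         chi a m n * chi b p q * raise1234 G (hodge3 G v chi) m n p q)"

text \<open>\<open>delta_Gamma G H s x a b c\<close> is \<open>\<delta>\<Gamma>\<^sub>a\<^sup>b\<^sub>c\<close>, where \<open>H\<close> is the deformed metric and the
  covariant derivatives are those of \<open>G\<close>.\<close>

definition delta_Gamma ::
  "(real^7 \<Rightarrow> real^7^7) \<Rightarrow> (real^7 \<Rightarrow> real^7^7) \<Rightarrow> (real^7 \<Rightarrow> cov2) \<Rightarrow> real^7 \<Rightarrow> cov3" where
  "delta_Gamma G H s x a b c =
     1 / 2 * sqrt (det (G x) / det (H x)) *
       ((\<Sum>d\<in>UNIV. matrix_inv (H x) $ b $ d *
           (nabla2 G s x c a d + nabla2 G s x a c d - nabla2 G s x d a c))
        - 1 / 9 * (\<Sum>e\<in>UNIV.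
           (of_bool (a = b) * of_bool (c = e) + of_bool (c = b) * of_bool (a = e)
              - H x $ a $ c * matrix_inv (H x) $ b $ e) *
           (\<Sum>m\<in>UNIV. \<Sum>n\<in>UNIV. matrix_inv (H x) $ m $ n * nabla2 G s x e m n)))"

end

theory Submission
  imports Defs
begin

text \<open>
  A positive 3-form is \<open>P\<^sup>* phi0\<close>, and then \<open>v = det P\<close> and \<open>g = P\<^sup>T P\<close>; hence the identities
  \<open>\<phi>\<^sub>e\<^sub>c\<^sub>d \<psi>\<^sup>m\<^sup>b\<^sup>c\<^sup>d = 4 \<phi>\<^sub>e\<^sup>m\<^sup>b\<close> and \<open>\<psi>\<^sub>e\<^sub>b\<^sub>c\<^sub>d \<psi>\<^sup>m\<^sup>b\<^sup>c\<^sup>d = 24 \<delta>\<^sub>e\<^sup>m\<close> need only be checked on \<open>phi0\<close>. Expanding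
  \<open>(u \<lrcorner> \<phi>') \<and> (w \<lrcorner> \<phi>') \<and> \<phi>'\<close> in \<open>\<phi>' = \<phi> + \<chi>\<close>, and merging the mixed terms by contracting vanishing
  8-forms, gives \<open>v' g' = v s\<close>. So \<open>\<nabla>g'\<close> is known from \<open>\<nabla>s\<close> up to the logarithmic derivative of
  \<open>v' / v\<close>, which the trace with \<open>g'\<close> determines; thus \<open>\<delta>\<Gamma>\<close> is the difference of the two Levi-Civita
  connections. Finally \<open>24 T'\<^sub>a\<^sup>m = (\<nabla>'\<^sub>a \<phi>'\<^sub>b\<^sub>c\<^sub>d) \<psi>'\<^sup>m\<^sup>b\<^sup>c\<^sup>d\<close>, where \<open>\<psi>'\<^sup>m\<^sup>b\<^sup>c\<^sup>d\<close> is \<open>v / v'\<close> times \<open>\<psi> + *\<chi>\<close> with its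
  indices raised by \<open>g\<close>, because without a metric the dual is linear in the 3-form.
\<close>

subsection \<open>Finite sums\<close>

text \<open>Lets a condition free of the bound variable leave its sum, so that nested sums over
  Kronecker deltas can be collapsed one index at a time.\<close>

lemma sum_if_const: "(\<Sum>x\<in>A. if P then f x else 0) = (if P then sum f A else 0)"
  by simp

lemma sum_bilinear:
  fixes a :: "'i::finite \<Rightarrow> real" and b :: "'j::finite \<Rightarrow> real"
  shows "(\<Sum>x\<in>S. (\<Sum>i\<in>UNIV. a i * A i x) * (\<Sum>p\<in>UNIV. b p * B p x))
    = (\<Sum>i\<in>UNIV. \<Sum>p\<in>UNIV. a i * b p * (\<Sum>x\<in>S. A i x * B p x))"
proof -
  have "(\<Sum>x\<in>S. (\<Sum>i\<in>UNIV. a i * A i x) * (\<Sum>p\<in>UNIV. b p * B p x))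
    = (\<Sum>x\<in>S. \<Sum>i\<in>UNIV. \<Sum>p\<in>UNIV. a i * b p * (A i x * B p x))"
    by (simp add: sum_product mult_ac)
  also have "\<dots> = (\<Sum>i\<in>UNIV. \<Sum>x\<in>S. \<Sum>p\<in>UNIV. a i * b p * (A i x * B p x))"
    by (rule sum.swap)
  also have "\<dots> = (\<Sum>i\<in>UNIV. \<Sum>p\<in>UNIV. \<Sum>x\<in>S. a i * b p * (A i x * B p x))"
    by (rule sum.cong[OF refl]) (rule sum.swap)
  finally show ?thesis by (simp add: sum_distrib_left)
qed

lemma sum_pairs: "(\<Sum>c\<in>C. \<Sum>d\<in>D. f c d) = (\<Sum>x\<in>C \<times> D. f (fst x) (snd x))"
  by (simp add: sum.cartesian_product case_prod_beta')

lemma sum_bilinear2: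
  fixes A B :: "7 \<Rightarrow> cov2"
  shows "(\<Sum>c\<in>UNIV. \<Sum>d\<in>UNIV. (\<Sum>i\<in>UNIV. a i * A i c d) * (\<Sum>p\<in>UNIV. b p * B p c d))
    = (\<Sum>i\<in>UNIV. \<Sum>p\<in>UNIV. a i * b p * (\<Sum>c\<in>UNIV. \<Sum>d\<in>UNIV. A i c d * B p c d))"
  unfolding sum_pairs[where f="\<lambda>c d. (\<Sum>i\<in>UNIV. a i * A i c d) * (\<Sum>p\<in>UNIV. b p * B p c d)"]
    sum_pairs[where f="\<lambda>c d. A _ c d * B _ c d"]
  by (rule sum_bilinear)

text \<open>Two rounds of \<open>sum_pairs\<close> turn the triple sum into a single sum over
  \<open>(c, (d, e))\<close>, to which \<open>sum_bilinear\<close> applies.\<close>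

lemma sum_bilinear3:
  fixes A B :: "7 \<Rightarrow> cov3"
  shows "(\<Sum>c\<in>UNIV. \<Sum>d\<in>UNIV. \<Sum>e\<in>UNIV. (\<Sum>i\<in>UNIV. a i * A i c d e) * (\<Sum>p\<in>UNIV. b p * B p c d e))
    = (\<Sum>i\<in>UNIV. \<Sum>p\<in>UNIV. a i * b p * (\<Sum>c\<in>UNIV. \<Sum>d\<in>UNIV. \<Sum>e\<in>UNIV. A i c d e * B p c d e))"
  unfolding sum_pairs[where f="\<lambda>d e. (\<Sum>i\<in>UNIV. a i * A i _ d e) * (\<Sum>p\<in>UNIV. b p * B p _ d e)"]
    sum_pairs[where f="\<lambda>d e. A _ _ d e * B _ _ d e"]
  unfolding sum_pairs[where f="\<lambda>c x. (\<Sum>i\<in>UNIV. a i * A i c (fst x) (snd x)) * (\<Sum>p\<in>UNIV. b p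
      * B p c (fst x) (snd x))"]
    sum_pairs[where f="\<lambda>c x. A _ c (fst x) (snd x) * B _ c (fst x) (snd x)"]
  by (rule sum_bilinear)

lemma sum_linear2:
  fixes X :: cov2 and Y :: "7 \<Rightarrow> cov2"
  shows "(\<Sum>c\<in>UNIV. \<Sum>d\<in>UNIV. X c d * (\<Sum>q\<in>UNIV. r q * Y q c d))
    = (\<Sum>q\<in>UNIV. r q * (\<Sum>c\<in>UNIV. \<Sum>d\<in>UNIV. X c d * Y q c d))"
proof -
  have "(\<Sum>c\<in>UNIV. \<Sum>d\<in>UNIV. X c d * (\<Sum>q\<in>UNIV. r q * Y q c d))
    = (\<Sum>c\<in>UNIV. \<Sum>q\<in>UNIV. \<Sum>d\<in>UNIV. X c d * (r q * Y q c d))"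
    unfolding sum_distrib_left by (rule sum.cong[OF refl]) (rule sum.swap)
  also have "\<dots> = (\<Sum>q\<in>UNIV. \<Sum>c\<in>UNIV. \<Sum>d\<in>UNIV. X c d * (r q * Y q c d))"
    by (rule sum.swap)
  finally show ?thesis by (simp add: sum_distrib_left mult_ac)
qed

lemma sum_linear3:
  fixes X :: cov3 and Y :: "7 \<Rightarrow> cov3"
  shows "(\<Sum>b\<in>UNIV. \<Sum>c\<in>UNIV. \<Sum>d\<in>UNIV. (\<Sum>e\<in>UNIV. t e * Y e b c d) * X b c d)
    = (\<Sum>e\<in>UNIV. t e * (\<Sum>b\<in>UNIV. \<Sum>c\<in>UNIV. \<Sum>d\<in>UNIV. Y e b c d * X b c d))"
proof -
  have "(\<Sum>c\<in>UNIV. \<Sum>d\<in>UNIV. (\<Sum>e\<in>UNIV. t e * Y e b c d) * X b c d)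
    = (\<Sum>e\<in>UNIV. t e * (\<Sum>c\<in>UNIV. \<Sum>d\<in>UNIV. Y e b c d * X b c d))" for b
    using sum_linear2[of "X b" t "\<lambda>e. Y e b"] by (simp add: mult.commute)
  then show ?thesis
    by (simp only:) (subst sum.swap, simp only: sum_distrib_left)
qed

text \<open>Brings the contraction of \<open>k\<close> with \<open>h\<close> innermost; with
  \<open>k\<close> an inverse metric and \<open>h\<close> the metric it then becomes a Kronecker
  delta.\<close>

lemma sum_contract_swap:
  fixes k :: "'a::finite \<Rightarrow> 'b::finite \<Rightarrow> real"
  shows "(\<Sum>m\<in>UNIV. \<Sum>n\<in>UNIV. k m n * (\<Sum>e\<in>UNIV. t e n * h m e))
    = (\<Sum>n\<in>UNIV. \<Sum>e\<in>UNIV. t e n * (\<Sum>m\<in>UNIV. k m n * h m e))"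
proof -
  have "(\<Sum>m\<in>UNIV. \<Sum>n\<in>UNIV. k m n * (\<Sum>e\<in>UNIV. t e n * h m e))
    = (\<Sum>n\<in>UNIV. \<Sum>m\<in>UNIV. \<Sum>e\<in>UNIV. k m n * (t e n * h m e))"
    unfolding sum_distrib_left by (rule sum.swap)
  also have "\<dots> = (\<Sum>n\<in>UNIV. \<Sum>e\<in>UNIV. \<Sum>m\<in>UNIV. k m n * (t e n * h m e))"
    by (rule sum.cong[OF refl]) (rule sum.swap)
  finally show ?thesis by (simp add: sum_distrib_left mult_ac)
qed

lemma UNIV_7: "(UNIV::7 set) = {1,2,3,4,5,6,7}"
proof -
  have "card {1,2,3,4,5,6,7::7} = 7" by simp
  then show ?thesis by (intro card_subset_eq[symmetric]) auto
qed

lemma sum_7: "sum f (UNIV::7 set) = f 1 + f 2 + f 3 + f 4 + f 5 + f 6 + f 7"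
  unfolding UNIV_7 by (simp add: ac_simps)

lemma prod_7: "prod f (UNIV::7 set) = f 1 * f 2 * f 3 * f 4 * f 5 * f 6 * f 7"
  unfolding UNIV_7 by (simp add: ac_simps)

lemma forall_7: "(\<forall>x::7. P x) \<longleftrightarrow> P 1 \<and> P 2 \<and> P 3 \<and> P 4 \<and> P 5 \<and> P 6 \<and> P 7"
  using UNIV_7 by (metis (mono_tags, lifting) UNIV_I empty_iff insert_iff)

subsection \<open>The Levi-Civita symbol\<close>

text \<open>In the type \<open>7\<close> the numeral \<open>7\<close> is \<open>0\<close>, so the order of that type puts it first; the
  indices are ordered by \<open>pos7\<close> instead.\<close>

definition pos7 :: "7 \<Rightarrow> real" where
  "pos7 x = (if x = 1 then 1 else if x = 2 then 2 else if x = 3 then 3 else if x = 4 then 4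
     else if x = 5 then 5 else if x = 6 then 6 else 7)"

definition sgn7 :: "7 \<Rightarrow> 7 \<Rightarrow> real" where
  "sgn7 x y = sgn (pos7 y - pos7 x)"

text \<open>A product over the pairs of slots rather than the sign of a permutation, so that the simplifier
  can evaluate it on numerals.\<close>

definition eps7 :: "7 \<Rightarrow> 7 \<Rightarrow> 7 \<Rightarrow> 7 \<Rightarrow> 7 \<Rightarrow> 7 \<Rightarrow> 7 \<Rightarrow> real" where
  "eps7 a b c d e f g =
     sgn7 a b * sgn7 a c * sgn7 a d * sgn7 a e * sgn7 a f * sgn7 a g *
     sgn7 b c * sgn7 b d * sgn7 b e * sgn7 b f * sgn7 b g *
     sgn7 c d * sgn7 c e * sgn7 c f * sgn7 c g *
     sgn7 d e * sgn7 d f * sgn7 d g * sgn7 e f * sgn7 e g * sgn7 f g"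

lemma pos7_simps: "pos7 1 = 1" "pos7 2 = 2" "pos7 3 = 3" "pos7 4 = 4" "pos7 5 = 5" "pos7 6 = 6"
    "pos7 7 = 7"
  by (simp_all add: pos7_def)

lemma sgn7_same [simp]: "sgn7 x x = 0"
  by (simp add: sgn7_def)

lemma sgn7_swap: "sgn7 y x = - sgn7 x y"
  unfolding sgn7_def by (metis minus_diff_eq sgn_minus)

text \<open>Exchanging two slots at distance \<open>d\<close> reverses \<open>2 * d - 1\<close> of
  the factors, an odd number. All 21 exchanges are listed, in lexicographic order of the
  slots.\<close>

lemma eps7_swap:
  "eps7 b a c d e f g = - eps7 a b c d e f g"
  "eps7 c b a d e f g = - eps7 a b c d e f g"
  "eps7 d b c a e f g = - eps7 a b c d e f g"
  "eps7 e b c d a f g = - eps7 a b c d e f g"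
  "eps7 f b c d e a g = - eps7 a b c d e f g"
  "eps7 g b c d e f a = - eps7 a b c d e f g"
  "eps7 a c b d e f g = - eps7 a b c d e f g"
  "eps7 a d c b e f g = - eps7 a b c d e f g"
  "eps7 a e c d b f g = - eps7 a b c d e f g"
  "eps7 a f c d e b g = - eps7 a b c d e f g"
  "eps7 a g c d e f b = - eps7 a b c d e f g"
  "eps7 a b d c e f g = - eps7 a b c d e f g"
  "eps7 a b e d c f g = - eps7 a b c d e f g"
  "eps7 a b f d e c g = - eps7 a b c d e f g"
  "eps7 a b g d e f c = - eps7 a b c d e f g"
  "eps7 a b c e d f g = - eps7 a b c d e f g"
  "eps7 a b c f e d g = - eps7 a b c d e f g"
  "eps7 a b c g e f d = - eps7 a b c d e f g"
  "eps7 a b c d f e g = - eps7 a b c d e f g"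
  "eps7 a b c d g f e = - eps7 a b c d e f g"
  "eps7 a b c d e g f = - eps7 a b c d e f g"
  unfolding eps7_def
  by (simp_all only: sgn7_swap[of b a] sgn7_swap[of c a] sgn7_swap[of d a] sgn7_swap[of e a]
      sgn7_swap[of f a] sgn7_swap[of g a] sgn7_swap[of c b] sgn7_swap[of d b] sgn7_swap[of e b]
      sgn7_swap[of f b] sgn7_swap[of g b] sgn7_swap[of d c] sgn7_swap[of e c] sgn7_swap[of f c]
      sgn7_swap[of g c] sgn7_swap[of e d] sgn7_swap[of f d] sgn7_swap[of g d] sgn7_swap[of f e]
      sgn7_swap[of g e] sgn7_swap[of g f]
      mult_minus_left mult_minus_right minus_minus mult.commute mult.left_commute mult.assoc)

text \<open>Here \<open>a\<close> and \<open>b\<close> are slot numbers, not index values. Running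
  through all pairs of slots leaves exactly the instances of \<open>eps7_swap\<close>.\<close>

lemma eps7_transpose:
  fixes f :: "7 \<Rightarrow> 7"
  assumes "a \<noteq> b"
  defines "h \<equiv> f \<circ> Transposition.transpose a b"
  shows "eps7 (h 1) (h 2) (h 3) (h 4) (h 5) (h 6) (h 7) =
    - eps7 (f 1) (f 2) (f 3) (f 4) (f 5) (f 6) (f 7)"
proof -
  have "\<forall>a b. a \<noteq> b \<longrightarrow> (let h = f \<circ> Transposition.transpose a b in
    eps7 (h 1) (h 2) (h 3) (h 4) (h 5) (h 6) (h 7) =
    - eps7 (f 1) (f 2) (f 3) (f 4) (f 5) (f 6) (f 7))"
    unfolding forall_7 Let_def o_def
    by (simp add: Transposition.transpose_def eps7_swap[where a="f 1" and b="f 2" and c="f 3" and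
        d="f 4"
      and e="f 5" and f="f 6" and g="f 7"])
  then show ?thesis using assms by (simp add: Let_def)
qed

lemma sgn7_numerals:
  "sgn7 1 2 = 1" "sgn7 1 3 = 1" "sgn7 1 4 = 1" "sgn7 1 5 = 1" "sgn7 1 6 = 1" "sgn7 1 7 = 1"
  "sgn7 2 1 = -1" "sgn7 2 3 = 1" "sgn7 2 4 = 1" "sgn7 2 5 = 1" "sgn7 2 6 = 1" "sgn7 2 7 = 1"
  "sgn7 3 1 = -1" "sgn7 3 2 = -1" "sgn7 3 4 = 1" "sgn7 3 5 = 1" "sgn7 3 6 = 1" "sgn7 3 7 = 1"
  "sgn7 4 1 = -1" "sgn7 4 2 = -1" "sgn7 4 3 = -1" "sgn7 4 5 = 1" "sgn7 4 6 = 1" "sgn7 4 7 = 1"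
  "sgn7 5 1 = -1" "sgn7 5 2 = -1" "sgn7 5 3 = -1" "sgn7 5 4 = -1" "sgn7 5 6 = 1" "sgn7 5 7 = 1"
  "sgn7 6 1 = -1" "sgn7 6 2 = -1" "sgn7 6 3 = -1" "sgn7 6 4 = -1" "sgn7 6 5 = -1" "sgn7 6 7 = 1"
  "sgn7 7 1 = -1" "sgn7 7 2 = -1" "sgn7 7 3 = -1" "sgn7 7 4 = -1" "sgn7 7 5 = -1" "sgn7 7 6 = -1"
  by (simp_all add: sgn7_def pos7_simps)

lemma eps7_same [simp]:
  "eps7 a a c d e f g = 0"
  "eps7 a b a d e f g = 0"
  "eps7 a b c a e f g = 0"
  "eps7 a b c d a f g = 0"
  "eps7 a b c d e a g = 0"
  "eps7 a b c d e f a = 0"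
  "eps7 a b b d e f g = 0"
  "eps7 a b c b e f g = 0"
  "eps7 a b c d b f g = 0"
  "eps7 a b c d e b g = 0"
  "eps7 a b c d e f b = 0"
  "eps7 a b c c e f g = 0"
  "eps7 a b c d c f g = 0"
  "eps7 a b c d e c g = 0"
  "eps7 a b c d e f c = 0"
  "eps7 a b c d d f g = 0"
  "eps7 a b c d e d g = 0"
  "eps7 a b c d e f d = 0"
  "eps7 a b c d e e g = 0"
  "eps7 a b c d e f e = 0"
  "eps7 a b c d e f f = 0"
  by (simp_all add: eps7_def)

subsection \<open>The model form and its dual\<close>

text \<open>These are the signed lines of the Fano plane occurring in \<open>phi0\<close>: every
  index lies on three lines, and two distinct lines share one index.\<close>

definition sum_triples :: "(7 \<Rightarrow> 7 \<Rightarrow> 7 \<Rightarrow> real) \<Rightarrow> real" where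
  "sum_triples X = X 1 2 3 + X 1 4 5 + X 1 6 7 + X 2 4 6 - X 2 5 7 - X 3 4 7 - X 3 5 6"

text \<open>The Hodge dual of \<open>phi0\<close> for the standard metric and orientation;
  \<open>dual3_phi0\<close> links it to the general construction.\<close>

definition psi0 :: cov4 where
  "psi0 m b c d = sum_triples (\<lambda>i j k. eps7 i j k m b c d)"

text \<open>The determinant has six terms, each a signed product of three Kronecker deltas, and each
  delta removes one sum.\<close>

lemma sum_basis3:
  "(\<Sum>a\<in>UNIV. \<Sum>b\<in>UNIV. \<Sum>c\<in>UNIV. basis3 i j k a b c * X a b c) =
     X i j k - X i k j - X j i k + X j k i + X k i j - X k j i"
  by (simp add: basis3_def det_3 algebra_simps of_bool_def if_distrib[where f="\<lambda>t. _ * t"]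
      if_distrib[where f="\<lambda>t. t * _"]
     sum.distrib sum_subtractf sum_if_const sum.delta' sum.delta sum_negf cong: if_cong)

lemma sum_basis3_tail:
  "(\<Sum>b\<in>UNIV. \<Sum>c\<in>UNIV. basis3 i j k a b c * X b c) =
     of_bool (i = a) * (X j k - X k j) + of_bool (j = a) * (X k i - X i k) + of_bool (k
         = a) * (X i j - X j i)"
  by (simp add: basis3_def det_3 algebra_simps of_bool_def if_distrib[where f="\<lambda>t. _ * t"]
      if_distrib[where f="\<lambda>t. t * _"]
     sum.distrib sum_subtractf sum_if_const sum.delta' sum.delta sum_negf cong: if_cong)

lemma basis3_swap: "basis3 i j k b a c = - basis3 i j k a b c"
    "basis3 i j k a c b = - basis3 i j k a b c"
  by (simp_all add: basis3_def det_3)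

lemma phi0_eq: "phi0 a b c = sum_triples (\<lambda>i j k. basis3 i j k a b c)"
  by (simp add: phi0_def sum_triples_def)

lemma sum_phi0:
  "(\<Sum>a\<in>UNIV. \<Sum>b\<in>UNIV. \<Sum>c\<in>UNIV. phi0 a b c * X a b c) =
     sum_triples (\<lambda>i j k. X i j k - X i k j - X j i k + X j k i + X k i j - X k j i)"
  unfolding phi0_eq sum_triples_def
  by (simp only: distrib_right left_diff_distrib sum.distrib sum_subtractf sum_basis3)

lemma sum_phi0_tail:
  "(\<Sum>b\<in>UNIV. \<Sum>c\<in>UNIV. phi0 a b c * X b c) =
     sum_triples (\<lambda>i j k. of_bool (i = a) * (X j k - X k j) + of_bool (j = a) * (X k i - X i k)
       + of_bool (k = a) * (X i j - X j i))"
  unfolding phi0_eq sum_triples_def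
  by (simp only: distrib_right left_diff_distrib sum.distrib sum_subtractf sum_basis3_tail)

lemma psi0_swap:
  "psi0 b a c d = - psi0 a b c d" "psi0 a c b d = - psi0 a b c d" "psi0 a b d c = - psi0 a b c d"
proof -
  have e: "eps7 i j k b a c d = - eps7 i j k a b c d" "eps7 i j k a c b d = - eps7 i j k a b c d"
    "eps7 i j k a b d c = - eps7 i j k a b c d" for i j k
    by (rule eps7_swap)+
  show "psi0 b a c d = - psi0 a b c d" "psi0 a c b d = - psi0 a b c d"
      "psi0 a b d c = - psi0 a b c d"
    by (simp_all add: psi0_def sum_triples_def e(1)) (simp_all add: e(2,3))
qed

lemma phi0_swap: "phi0 b a c = - phi0 a b c" "phi0 a c b = - phi0 a b c"
  by (simp_all add: phi0_def basis3_swap(1)[of _ _ _ b a c] basis3_swap(2)[of _ _ _ a c b])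

text \<open>Each index lies in three of the seven triples, and antisymmetry of \<open>X\<close>
  doubles each contribution. The 49-term sums thus shrink to three terms, which keeps the later case
  checks small.\<close>

lemma phi0_contract:
  assumes X: "\<And>b c. X b c = - X c b"
  shows "(\<Sum>b\<in>UNIV. \<Sum>c\<in>UNIV. phi0 1 b c * X b c) = 2 * (X 2 3 + X 4 5 + X 6 7)"
    "(\<Sum>b\<in>UNIV. \<Sum>c\<in>UNIV. phi0 2 b c * X b c) = 2 * (- X 1 3 + X 4 6 - X 5 7)"
    "(\<Sum>b\<in>UNIV. \<Sum>c\<in>UNIV. phi0 3 b c * X b c) = 2 * (X 1 2 - X 4 7 - X 5 6)"
    "(\<Sum>b\<in>UNIV. \<Sum>c\<in>UNIV. phi0 4 b c * X b c) = 2 * (- X 1 5 - X 2 6 + X 3 7)"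
    "(\<Sum>b\<in>UNIV. \<Sum>c\<in>UNIV. phi0 5 b c * X b c) = 2 * (X 1 4 + X 2 7 + X 3 6)"
    "(\<Sum>b\<in>UNIV. \<Sum>c\<in>UNIV. phi0 6 b c * X b c) = 2 * (- X 1 7 + X 2 4 - X 3 5)"
    "(\<Sum>b\<in>UNIV. \<Sum>c\<in>UNIV. phi0 7 b c * X b c) = 2 * (X 1 6 - X 2 5 - X 3 4)"
  unfolding sum_phi0_tail sum_triples_def
  by (simp_all add: X[of 2 1] X[of 3 1] X[of 4 1] X[of 5 1] X[of 6 1] X[of 7 1] X[of 3 2]
      X[of 4 2] X[of 5 2] X[of 6 2] X[of 7 2] X[of 4 3] X[of 5 3] X[of 6 3] X[of 7 3] X[of 5 4]
      X[of 6 4] X[of 7 4] X[of 6 5] X[of 7 5] X[of 7 6])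

text \<open>The 6 counts three triples through an index, with two orders of the remaining pair each.
  For distinct \<open>a\<close> and \<open>d\<close> there is no common pair, as distinct triples
  share a single index.\<close>

lemma phi0_phi0: "(\<Sum>b\<in>UNIV. \<Sum>c\<in>UNIV. phi0 a b c * phi0 d b c) = 6 * of_bool (a = d)"
proof -
  have "\<forall>a d. (\<Sum>b\<in>UNIV. \<Sum>c\<in>UNIV. phi0 a b c * phi0 d b c) = 6 * of_bool (a = d)"
    unfolding forall_7 phi0_contract[OF phi0_swap(2)] by (simp add: phi0_def basis3_def det_3)
  then show ?thesis by blast
qed

text \<open>After \<open>phi0_contract\<close>, each of the 343 cases is an evaluation of three
  components of \<open>psi0\<close>.\<close>

lemma phi0_psi0: "(\<Sum>c\<in>UNIV. \<Sum>d\<in>UNIV. phi0 e c d * psi0 m b c d) = 4 * phi0 e m b"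
proof -
  have "\<forall>e m b. (\<Sum>c\<in>UNIV. \<Sum>d\<in>UNIV. phi0 e c d * psi0 m b c d) = 4 * phi0 e m b"
    unfolding forall_7 phi0_contract[OF psi0_swap(3)]
    by (simp add: phi0_def basis3_def det_3 psi0_def sum_triples_def eps7_def sgn7_numerals)
  then show ?thesis by blast
qed

text \<open>Both factors alternate in the last three slots, so the six arrangements of \<open>q\<close>, \<open>r\<close>, \<open>s\<close> contribute
  equally and all other terms vanish.\<close>

lemma eps7_contract:
  assumes d: "distinct [i, j, k, e, q, r, s]" and Y: "alternating3 Y"
  shows "(\<Sum>b\<in>UNIV. \<Sum>c\<in>UNIV. \<Sum>d\<in>UNIV. eps7 i j k e b c d * Y b c d)
     = 6 * eps7 i j k e q r s * Y q r s"
proof -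
  have U: "UNIV = {i, j, k, e, q, r, s}"
    by (rule card_subset_eq[symmetric]) (use d in \<open>auto simp: card_insert_if\<close>)
  have Y1: "Y r q c = - Y q r c" "Y s q c = - Y q s c" "Y s r c = - Y r s c"
    "Y c r q = - Y c q r" "Y c s q = - Y c q s" "Y c s r = - Y c r s" for c
    using Y unfolding alternating3_def by blast+
  have red: "(\<Sum>x\<in>UNIV. f x) = f q + f r + f s" if "\<And>x. x \<in> {i, j, k, e} \<Longrightarrow> f x
      = 0" for f :: "7 \<Rightarrow> real"
    unfolding U using d that by (simp add: ac_simps)
  have E: "eps7 i j k e q s r = - eps7 i j k e q r s" "eps7 i j k e r q s = - eps7 i j k e q r s"
    "eps7 i j k e s r q = - eps7 i j k e q r s" "eps7 i j k e s q r = eps7 i j k e q r s"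
    "eps7 i j k e r s q = eps7 i j k e q r s"
    using eps7_swap(16,19,21)[where a=i and b=j and c=k and d=e] by (metis add.inverse_inverse)+
  have "(\<Sum>b\<in>UNIV. \<Sum>c\<in>UNIV. \<Sum>d\<in>UNIV. eps7 i j k e b c d * Y b c d)
    = (\<Sum>b\<in>UNIV. \<Sum>c\<in>UNIV. eps7 i j k e b c q * Y b c q + eps7 i j k e b c r * Y b c r
        + eps7 i j k e b c s * Y b c s)"
    by (subst red) (auto simp: ac_simps)
  also have "\<dots> = (\<Sum>b\<in>UNIV. eps7 i j k e b q r * Y b q r + eps7 i j k e b q s * Y b q s +
     eps7 i j k e b r q * Y b r q + eps7 i j k e b r s * Y b r s + eps7 i j k e b s q * Y b s q
         + eps7 i j k e b s r * Y b s r)"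
    by (subst red) (auto simp: ac_simps)
  also have "\<dots> = 6 * eps7 i j k e q r s * Y q r s"
    by (subst red) (auto simp: E Y1)
  finally show ?thesis .
qed

text \<open>For each index \<open>e\<close>, four triples of \<open>phi0\<close> avoid
  \<open>e\<close>; each entry lists such a triple, then \<open>e\<close>, then the three indices
  left over.\<close>

lemma eps7_numerals:
  "eps7 2 4 6 1 3 5 7 = 1"
  "eps7 2 5 7 1 3 4 6 = 1"
  "eps7 3 4 7 1 2 5 6 = 1"
  "eps7 3 5 6 1 2 4 7 = 1"
  "eps7 1 4 5 2 3 6 7 = 1"
  "eps7 1 6 7 2 3 4 5 = 1"
  "eps7 3 4 7 2 1 5 6 = -1"
  "eps7 3 5 6 2 1 4 7 = -1"
  "eps7 1 4 5 3 2 6 7 = -1"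
  "eps7 1 6 7 3 2 4 5 = -1"
  "eps7 2 4 6 3 1 5 7 = -1"
  "eps7 2 5 7 3 1 4 6 = -1"
  "eps7 1 2 3 4 5 6 7 = 1"
  "eps7 1 6 7 4 2 3 5 = 1"
  "eps7 2 5 7 4 1 3 6 = 1"
  "eps7 3 5 6 4 1 2 7 = 1"
  "eps7 1 2 3 5 4 6 7 = -1"
  "eps7 1 6 7 5 2 3 4 = -1"
  "eps7 2 4 6 5 1 3 7 = 1"
  "eps7 3 4 7 5 1 2 6 = 1"
  "eps7 1 2 3 6 4 5 7 = 1"
  "eps7 1 4 5 6 2 3 7 = 1"
  "eps7 2 5 7 6 1 3 4 = -1"
  "eps7 3 4 7 6 1 2 5 = -1"
  "eps7 1 2 3 7 4 5 6 = -1"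
  "eps7 1 4 5 7 2 3 6 = -1"
  "eps7 2 4 6 7 1 3 5 = -1"
  "eps7 3 5 6 7 1 2 4 = -1"
  by (simp_all add: eps7_def sgn7_numerals)

lemma sum_psi0:
  "(\<Sum>b\<in>UNIV. \<Sum>c\<in>UNIV. \<Sum>d\<in>UNIV. psi0 e b c d * Y b c d) =
    sum_triples (\<lambda>i j k. \<Sum>b\<in>UNIV. \<Sum>c\<in>UNIV. \<Sum>d\<in>UNIV. eps7 i j k e b c d * Y b c d)"
  unfolding psi0_def sum_triples_def
  by (simp only: distrib_right left_diff_distrib sum.distrib sum_subtractf)

text \<open>Triples containing the first index of \<open>psi0\<close> drop out by
  \<open>eps7_same\<close>; each of the four others is evaluated by
  \<open>eps7_contract\<close>.\<close>

lemma psi0_contract: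
  assumes Y: "alternating3 Y"
  shows "(\<Sum>b\<in>UNIV. \<Sum>c\<in>UNIV. \<Sum>d\<in>UNIV. psi0 1 b c d * Y b c d)
      = 6 * (Y 3 5 7 - Y 3 4 6 - Y 2 5 6 - Y 2 4 7)"
    "(\<Sum>b\<in>UNIV. \<Sum>c\<in>UNIV. \<Sum>d\<in>UNIV. psi0 2 b c d * Y b c d)
        = 6 * (Y 3 6 7 + Y 3 4 5 + Y 1 5 6 + Y 1 4 7)"
    "(\<Sum>b\<in>UNIV. \<Sum>c\<in>UNIV. \<Sum>d\<in>UNIV. psi0 3 b c d * Y b c d)
        = 6 * (- Y 2 6 7 - Y 2 4 5 - Y 1 5 7 + Y 1 4 6)"
    "(\<Sum>b\<in>UNIV. \<Sum>c\<in>UNIV. \<Sum>d\<in>UNIV. psi0 4 b c d * Y b c d)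
        = 6 * (Y 5 6 7 + Y 2 3 5 - Y 1 3 6 - Y 1 2 7)"
    "(\<Sum>b\<in>UNIV. \<Sum>c\<in>UNIV. \<Sum>d\<in>UNIV. psi0 5 b c d * Y b c d)
        = 6 * (- Y 4 6 7 - Y 2 3 4 + Y 1 3 7 - Y 1 2 6)"
    "(\<Sum>b\<in>UNIV. \<Sum>c\<in>UNIV. \<Sum>d\<in>UNIV. psi0 6 b c d * Y b c d)
        = 6 * (Y 4 5 7 + Y 2 3 7 + Y 1 3 4 + Y 1 2 5)"
    "(\<Sum>b\<in>UNIV. \<Sum>c\<in>UNIV. \<Sum>d\<in>UNIV. psi0 7 b c d * Y b c d)
        = 6 * (- Y 4 5 6 - Y 2 3 6 - Y 1 3 5 + Y 1 2 4)"
  by (simp_all add: sum_psi0 sum_triples_def Y eps7_numerals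
    eps7_contract[of 2 4 6 1 3 5 7]
    eps7_contract[of 2 5 7 1 3 4 6]
    eps7_contract[of 3 4 7 1 2 5 6]
    eps7_contract[of 3 5 6 1 2 4 7]
    eps7_contract[of 1 4 5 2 3 6 7]
    eps7_contract[of 1 6 7 2 3 4 5]
    eps7_contract[of 3 4 7 2 1 5 6]
    eps7_contract[of 3 5 6 2 1 4 7]
    eps7_contract[of 1 4 5 3 2 6 7]
    eps7_contract[of 1 6 7 3 2 4 5]
    eps7_contract[of 2 4 6 3 1 5 7]
    eps7_contract[of 2 5 7 3 1 4 6]
    eps7_contract[of 1 2 3 4 5 6 7]
    eps7_contract[of 1 6 7 4 2 3 5]
    eps7_contract[of 2 5 7 4 1 3 6]
    eps7_contract[of 3 5 6 4 1 2 7]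
    eps7_contract[of 1 2 3 5 4 6 7]
    eps7_contract[of 1 6 7 5 2 3 4]
    eps7_contract[of 2 4 6 5 1 3 7]
    eps7_contract[of 3 4 7 5 1 2 6]
    eps7_contract[of 1 2 3 6 4 5 7]
    eps7_contract[of 1 4 5 6 2 3 7]
    eps7_contract[of 2 5 7 6 1 3 4]
    eps7_contract[of 3 4 7 6 1 2 5]
    eps7_contract[of 1 2 3 7 4 5 6]
    eps7_contract[of 1 4 5 7 2 3 6]
    eps7_contract[of 2 4 6 7 1 3 5]
    eps7_contract[of 3 5 6 7 1 2 4])

text \<open>The 24 counts four triples complementary to an index, in six orders each. Two different
  quadruples of \<open>psi0\<close> share only two indices, so nothing survives off the
  diagonal.\<close>

lemma psi0_psi0: "(\<Sum>b\<in>UNIV. \<Sum>c\<in>UNIV. \<Sum>d\<in>UNIV. psi0 e b c d * psi0 m b c d) = 24 * of_bool (e = m)"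
proof -
  have a: "alternating3 (psi0 m)" for m
    unfolding alternating3_def using psi0_swap by (metis add.inverse_inverse)
  have "\<forall>e m. (\<Sum>b\<in>UNIV. \<Sum>c\<in>UNIV. \<Sum>d\<in>UNIV. psi0 e b c d * psi0 m b c d) = 24 * of_bool (e = m)"
    unfolding forall_7 psi0_contract[OF a]
    by (simp add: psi0_def sum_triples_def eps7_def sgn7_numerals)
  then show ?thesis by blast
qed

subsection \<open>Signed sums over permutations\<close>

text \<open>Both sides are 1 at the identity and change sign under composition with a transposition,
  so induction over transpositions applies.\<close>

lemma eps7_sign:
  assumes "\<sigma> permutes (UNIV :: 7 set)"
  shows "eps7 (\<sigma> 1) (\<sigma> 2) (\<sigma> 3) (\<sigma> 4) (\<sigma> 5) (\<sigma> 6) (\<sigma> 7) = of_int (sign \<sigma>)"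
  using finite[of "UNIV :: 7 set"] assms
proof (induction rule: permutes_rev_induct)
  case id
  then show ?case by (simp add: eps7_def sgn7_numerals sign_id)
next
  case (swap a b p)
  have "sign (p \<circ> Transposition.transpose a b) = - sign p"
    using swap by (simp add: sign_compose permutation_swap_id sign_swap_id
        permutes_imp_permutation[OF finite])
  then show ?case
    using eps7_transpose[OF \<open>a \<noteq> b\<close>, of p] swap by (simp add: o_def)
qed

lemma eps7_not_inj:
  fixes f :: "7 \<Rightarrow> 7"
  assumes "\<not> inj f"
  shows "eps7 (f 1) (f 2) (f 3) (f 4) (f 5) (f 6) (f 7) = 0"
proof -
  have "\<forall>x y. x \<noteq> y \<longrightarrow> f x = f y \<longrightarrow> eps7 (f 1) (f 2) (f 3) (f 4) (f 5) (f 6) (f 7) = 0"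
    unfolding forall_7 by simp
  then show ?thesis using assms unfolding inj_def by metis
qed

section \<open>Seven-tuples as permutations, signed sums, and the dual without a metric\<close>

definition tuple7 :: "7 \<Rightarrow> 7 \<Rightarrow> 7 \<Rightarrow> 7 \<Rightarrow> 7 \<Rightarrow> 7 \<Rightarrow> 7 \<Rightarrow> 7 \<Rightarrow> 7" where
  "tuple7 a b c d e f g x = (if x = 1 then a else if x = 2 then b else if x = 3 then c
     else if x = 4 then d else if x = 5 then e else if x = 6 then f else g)"

lemma tuple7_simps [simp]:
  "tuple7 a b c d e f g 1 = a" "tuple7 a b c d e f g 2 = b" "tuple7 a b c d e f g 3 = c"
  "tuple7 a b c d e f g 4 = d" "tuple7 a b c d e f g 5 = e" "tuple7 a b c d e f g 6 = f"
  "tuple7 a b c d e f g 7 = g"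
  by (simp_all add: tuple7_def)

lemma inj_tuple7_if_eps7: "eps7 a b c d e f g \<noteq> 0 \<Longrightarrow> inj (tuple7 a b c d e f g)"
  using eps7_not_inj[of "tuple7 a b c d e f g"] by auto

lemma tuple7_self: "tuple7 (\<sigma> 1) (\<sigma> 2) (\<sigma> 3) (\<sigma> 4) (\<sigma> 5) (\<sigma> 6) (\<sigma> 7) = \<sigma>"
proof -
  have "\<forall>x. tuple7 (\<sigma> 1) (\<sigma> 2) (\<sigma> 3) (\<sigma> 4) (\<sigma> 5) (\<sigma> 6) (\<sigma> 7) x = \<sigma> x"
    unfolding forall_7 by simp
  then show ?thesis by blast
qed

lemma permutes_UNIV_7: "\<sigma> permutes (UNIV :: 7 set) \<longleftrightarrow> inj \<sigma>"
  by (metis finite_UNIV_inj_surj bij_def bij_imp_permutes finite permutes_inj UNIV_I)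

text \<open>Total antisymmetrization over the seven slots: up to a factorial factor, the coefficient
  of a product of forms of total degree 7.\<close>

definition signed_sum :: "((7 \<Rightarrow> 7) \<Rightarrow> real) \<Rightarrow> real" where
  "signed_sum F = (\<Sum>\<sigma> | \<sigma> permutes (UNIV :: 7 set). of_int (sign \<sigma>) * F \<sigma>)"

text \<open>The Hodge dual without a metric: its indices are upper ones, and it is \<open>v\<close> times the dual with
  all indices raised, as \<open>raise1234_hodge3\<close> below shows.\<close>

definition dual3 :: "cov3 \<Rightarrow> cov4" where
  "dual3 \<omega> m b c d = (\<Sum>i\<in>UNIV. \<Sum>j\<in>UNIV. \<Sum>k\<in>UNIV. \<omega> i j k * eps7 i j k m b c d) / 6"

text \<open>Triples \<open>(i, j, k)\<close> that complete the tail injectively correspond to the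
  permutations with that tail; all other triples are annihilated by \<open>eps7\<close>.\<close>

lemma sum_permutes_tail:
  "(\<Sum>\<sigma> | \<sigma> permutes (UNIV :: 7 set) \<and> \<sigma> 4 = m \<and> \<sigma> 5 = b \<and> \<sigma> 6 = c \<and> \<sigma> 7 = d.
      of_int (sign \<sigma>) * F (\<sigma> 1) (\<sigma> 2) (\<sigma> 3))
   = (\<Sum>i\<in>UNIV. \<Sum>j\<in>UNIV. \<Sum>k\<in>UNIV. F i j k * eps7 i j k m b c d)" (is "?l = ?r")
proof -
  let ?t = "\<lambda>(i, j, k). tuple7 i j k m b c d"
  have "?r = (\<Sum>(i, j, k)\<in>UNIV. F i j k * eps7 i j k m b c d)"
    by (simp add: sum.cartesian_product case_prod_beta' flip: UNIV_Times_UNIV)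
  also have "\<dots> = (\<Sum>(i, j, k) | inj (?t (i, j, k)). F i j k * eps7 i j k m b c d)"
    by (rule sum.mono_neutral_right) (auto intro: inj_tuple7_if_eps7)
  also have "\<dots> = ?l"
    by (rule sum.reindex_bij_witness[of _ "\<lambda>\<sigma>. (\<sigma> 1, \<sigma> 2, \<sigma> 3)" ?t])
      (auto simp: permutes_UNIV_7 tuple7_self eps7_sign[symmetric])
  finally show ?thesis by simp
qed

lemma hodge3_eq: "hodge3 G v \<omega> m b c d = v * dual3 (raise123 G \<omega>) m b c d"
  unfolding hodge3_def dual3_def sum_permutes_tail by simp

lemma sum_dual3:
  "(\<Sum>m\<in>UNIV. \<Sum>b\<in>UNIV. \<Sum>c\<in>UNIV. \<Sum>d\<in>UNIV. X m b c d * dual3 \<omega> m b c d)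
    = signed_sum (\<lambda>\<sigma>. \<omega> (\<sigma> 1) (\<sigma> 2) (\<sigma> 3) * X (\<sigma> 4) (\<sigma> 5) (\<sigma> 6) (\<sigma> 7)) / 6"
proof -
  let ?P = "{\<sigma>. \<sigma> permutes (UNIV :: 7 set)}"
  let ?s = "\<lambda>\<sigma>::7\<Rightarrow>7. of_int (sign \<sigma>) * \<omega> (\<sigma> 1) (\<sigma> 2) (\<sigma> 3) :: real"
  have fin: "finite ?P" by (simp add: finite_permutations)
  \<comment> \<open>One conditional per index, rather than a conjunction, lets each of the four
    outer sums be collapsed separately once the sum over permutations is outermost.\<close>
  have "X m b c d * dual3 \<omega> m b c d =
    (\<Sum>\<sigma>\<in>?P. if \<sigma> 4 = m then if \<sigma> 5 = b then if \<sigma> 6 = c then if \<sigma> 7 = d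
        then ?s \<sigma> * X m b c d else 0 else 0 else 0 else 0) / 6" for m b c d
  proof -
    have "(\<Sum>\<sigma>\<in>?P. if \<sigma> 4 = m then if \<sigma> 5 = b then if \<sigma> 6 = c then if \<sigma> 7 = d
        then ?s \<sigma> * X m b c d else 0 else 0 else 0 else 0)
      = (\<Sum>\<sigma> | \<sigma> permutes (UNIV :: 7 set) \<and> \<sigma> 4 = m \<and> \<sigma> 5 = b \<and> \<sigma> 6 = c \<and> \<sigma> 7 = d. ?s \<sigma> * X m b c d)"
      by (rule sum.mono_neutral_cong_right) (use fin in auto)
    then show ?thesis
      by (simp add: dual3_def sum_permutes_tail[symmetric] sum_distrib_right[symmetric])
  qed
  then have "(\<Sum>m\<in>UNIV. \<Sum>b\<in>UNIV. \<Sum>c\<in>UNIV. \<Sum>d\<in>UNIV. X m b c d * dual3 \<omega> m b c d)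
    = (\<Sum>m\<in>UNIV. \<Sum>b\<in>UNIV. \<Sum>c\<in>UNIV. \<Sum>d\<in>UNIV. \<Sum>\<sigma>\<in>?P. if \<sigma> 4 = m then if \<sigma> 5 = b then if \<sigma> 6
        = c then if \<sigma> 7 = d
        then ?s \<sigma> * X m b c d else 0 else 0 else 0 else 0) / 6"
    by (simp add: sum_divide_distrib)
  also have "\<dots> = (\<Sum>\<sigma>\<in>?P. \<Sum>m\<in>UNIV. \<Sum>b\<in>UNIV. \<Sum>c\<in>UNIV. \<Sum>d\<in>UNIV. if \<sigma> 4 = m then if \<sigma> 5
      = b then if \<sigma> 6 = c then if \<sigma> 7 = d
        then ?s \<sigma> * X m b c d else 0 else 0 else 0 else 0) / 6"
    by (simp only: sum.swap[of _ ?P UNIV])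
  also have "\<dots> = signed_sum (\<lambda>\<sigma>. \<omega> (\<sigma> 1) (\<sigma> 2) (\<sigma> 3) * X (\<sigma> 4) (\<sigma> 5) (\<sigma> 6) (\<sigma> 7)) / 6"
    unfolding signed_sum_def
    by (simp add: sum_if_const sum.delta sum.delta' mult.assoc)
  finally show ?thesis .
qed

lemma signed_sum_compose:
  assumes "inj \<pi>"
  shows "signed_sum (\<lambda>\<sigma>. F (\<sigma> \<circ> \<pi>)) = of_int (sign \<pi>) * signed_sum F"
proof -
  have p: "\<pi> permutes UNIV" using assms by (simp add: permutes_UNIV_7)
  have "signed_sum F = (\<Sum>\<sigma> | \<sigma> permutes UNIV. of_int (sign (\<sigma> \<circ> \<pi>)) * F (\<sigma> \<circ> \<pi>))"
    unfolding signed_sum_def by (rule sum_permutations_compose_right[OF p])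
  also have "\<dots> = (\<Sum>\<sigma> | \<sigma> permutes UNIV. of_int (sign \<pi>) * (of_int (sign \<sigma>) * F (\<sigma> \<circ> \<pi>)))"
    by (rule sum.cong) (use p in \<open>simp_all add: sign_compose permutes_imp_permutation[OF finite]\<close>)
  also have "\<dots> = of_int (sign \<pi>) * signed_sum (\<lambda>\<sigma>. F (\<sigma> \<circ> \<pi>))"
    by (simp add: signed_sum_def sum_distrib_left)
  finally have *: "signed_sum F = of_int (sign \<pi>) * signed_sum (\<lambda>\<sigma>. F (\<sigma> \<circ> \<pi>))" .
  show ?thesis
    unfolding * mult.assoc[symmetric] by (simp flip: of_int_mult)
qed

text \<open>The working form of invariance under relabelling: for concrete slots the sign is found
  by evaluating \<open>eps7\<close> on numerals.\<close>

lemma signed_sum_slots: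
  assumes "inj (tuple7 a b c d e f g)"
  shows "signed_sum (\<lambda>\<sigma>. F (\<sigma> a) (\<sigma> b) (\<sigma> c) (\<sigma> d) (\<sigma> e) (\<sigma> f) (\<sigma> g))
    = eps7 a b c d e f g * signed_sum (\<lambda>\<sigma>. F (\<sigma> 1) (\<sigma> 2) (\<sigma> 3) (\<sigma> 4) (\<sigma> 5) (\<sigma> 6) (\<sigma> 7))"
proof -
  have "eps7 a b c d e f g = of_int (sign (tuple7 a b c d e f g))"
    using eps7_sign[of "tuple7 a b c d e f g"] assms by (simp add: permutes_UNIV_7)
  then show ?thesis
    using signed_sum_compose[OF assms, of "\<lambda>\<sigma>. F (\<sigma> 1) (\<sigma> 2) (\<sigma> 3) (\<sigma> 4) (\<sigma> 5) (\<sigma> 6) (\<sigma> 7)"]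
    by simp
qed

lemma inj_tuple7: "inj (tuple7 a b c d e f g) \<longleftrightarrow> distinct [a, b, c, d, e, f, g]"
  unfolding inj_def forall_7 by (simp add: eq_commute) blast

lemma dual3_swap: "dual3 \<omega> m c b d = - dual3 \<omega> m b c d" "dual3 \<omega> m b d c = - dual3 \<omega> m b c d"
proof -
  have "eps7 i j k m c b d = - eps7 i j k m b c d"
      "eps7 i j k m b d c = - eps7 i j k m b c d" for i j k
    by (rule eps7_swap)+
  then show "dual3 \<omega> m c b d = - dual3 \<omega> m b c d" "dual3 \<omega> m b d c = - dual3 \<omega> m b c d"
    by (simp_all add: dual3_def sum_negf)
qed

lemma dual3_phi0: "dual3 phi0 = psi0"
proof (intro ext)
  fix m b c d
  \<comment> \<open>The six arrangements of a triple contribute equally, which cancels the factor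
    1/6 in \<open>dual3\<close>.\<close>
  have s: "eps7 i j k m b c d - eps7 i k j m b c d - eps7 j i k m b c d + eps7 j k i m b c d
      + eps7 k i j m b c d - eps7 k j i m b c d = 6 * eps7 i j k m b c d" for i j k
  proof -
    have "eps7 i k j m b c d = - eps7 i j k m b c d" "eps7 j i k m b c d = - eps7 i j k m b c d"
      "eps7 k j i m b c d = - eps7 i j k m b c d" "eps7 j k i m b c d = - eps7 j i k m b c d"
      "eps7 k i j m b c d = - eps7 i k j m b c d"
      by (rule eps7_swap)+
    then show ?thesis by linarith
  qed
  show "dual3 phi0 m b c d = psi0 m b c d"
    unfolding dual3_def sum_phi0 psi0_def s by (simp add: sum_triples_def)
qed
text \<open>Moving the 3-form from the last three slots to the front is an even permutation. Of the
  denominator 24, the dual absorbs 6.\<close>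

lemma wedge223_eq:
  "wedge223 \<alpha> \<beta> \<gamma> = (\<Sum>m\<in>UNIV. \<Sum>n\<in>UNIV. \<Sum>p\<in>UNIV. \<Sum>q\<in>UNIV. \<alpha> m n * \<beta> p q * dual3 \<gamma> m n p q) / 4"
proof -
  have "wedge223 \<alpha> \<beta> \<gamma> = signed_sum (\<lambda>\<sigma>. \<alpha> (\<sigma> 1) (\<sigma> 2) * \<beta> (\<sigma> 3) (\<sigma> 4) * \<gamma> (\<sigma> 5) (\<sigma> 6) (\<sigma> 7)) / 24"
    unfolding wedge223_def signed_sum_def by (simp add: mult.assoc)
  also have "signed_sum (\<lambda>\<sigma>. \<alpha> (\<sigma> 1) (\<sigma> 2) * \<beta> (\<sigma> 3) (\<sigma> 4) * \<gamma> (\<sigma> 5) (\<sigma> 6) (\<sigma> 7)) =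
     signed_sum (\<lambda>\<sigma>. \<gamma> (\<sigma> 1) (\<sigma> 2) (\<sigma> 3) * (\<alpha> (\<sigma> 4) (\<sigma> 5) * \<beta> (\<sigma> 6) (\<sigma> 7)))"
    using signed_sum_slots[of 4 5 6 7 1 2 3 "\<lambda>a b c d e f g. \<alpha> a b * \<beta> c d * \<gamma> e f g"]
    by (simp add: inj_tuple7 eps7_def sgn7_numerals mult_ac)
  finally show ?thesis by (simp add: sum_dual3)
qed

text \<open>The left side is the determinant of the matrix with rows \<open>a\<close> to
  \<open>g\<close> of \<open>Q\<close>: a row permutation of \<open>Q\<close>, or a matrix with a
  repeated row.\<close>

lemma signed_sum_det:
  "signed_sum (\<lambda>\<sigma>. Q$a$\<sigma> 1 * Q$b$\<sigma> 2 * Q$c$\<sigma> 3 * Q$d$\<sigma> 4 * Q$e$\<sigma> 5 * Q$f$\<sigma> 6 * Q$g$\<sigma> 7)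
    = eps7 a b c d e f g * det (Q :: real^7^7)"
proof -
  let ?t = "tuple7 a b c d e f g"
  have "signed_sum (\<lambda>\<sigma>. Q$a$\<sigma> 1 * Q$b$\<sigma> 2 * Q$c$\<sigma> 3 * Q$d$\<sigma> 4 * Q$e$\<sigma> 5 * Q$f$\<sigma> 6 * Q$g$\<sigma> 7)
    = det (\<chi> i. Q $ ?t i)"
    unfolding det_def signed_sum_def prod_7 by simp
  also have "\<dots> = eps7 a b c d e f g * det Q"
  proof (cases "inj ?t")
    case True
    then have "?t permutes UNIV" by (simp add: permutes_UNIV_7)
    then show ?thesis
      using eps7_sign[of ?t] by (simp add: det_permute_rows)
  next
    case False
    then obtain x y where "x \<noteq> y" "?t x = ?t y" by (auto simp: inj_def)
    then have "det (\<chi> i. Q $ ?t i) = 0"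
      by (intro det_identical_rows[of x y]) (auto simp: row_def)
    then show ?thesis using eps7_not_inj[OF False] by simp
  qed
  finally show ?thesis .
qed

text \<open>Contraction with \<open>u\<close> of an 8-form, which vanishes in dimension 7: among the terms on the right,
  those with \<open>\<sigma> k = u\<close> give the left-hand side, and a term with \<open>\<sigma> k \<noteq> u\<close>, \<open>\<sigma> l = u\<close> cancels against the
  one for \<open>\<sigma> \<circ> (k l)\<close> and \<open>l\<close>.\<close>

lemma signed_sum_replace: "signed_sum (\<lambda>\<sigma>. F \<sigma> u) = (\<Sum>k\<in>UNIV. signed_sum (\<lambda>\<sigma>. F (\<sigma>(k := u)) (\<sigma> k)))"
proof -
  let ?P = "{\<sigma>. \<sigma> permutes (UNIV :: 7 set)}"
  let ?f = "\<lambda>(k, \<sigma>). of_int (sign \<sigma>) * F (\<sigma>(k := u)) (\<sigma> k) :: real"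
  let ?A = "{(k, \<sigma>). \<sigma> permutes (UNIV :: 7 set) \<and> \<sigma> k = u}"
  let ?B = "{(k, \<sigma>). \<sigma> permutes (UNIV :: 7 set) \<and> \<sigma> k \<noteq> u}"
  let ?h = "\<lambda>(k, \<sigma>). (inv \<sigma> u, \<sigma> \<circ> Transposition.transpose k (inv \<sigma> u))"
  have fin: "finite ?P" by (simp add: finite_permutations)
  have "(\<Sum>k\<in>UNIV. signed_sum (\<lambda>\<sigma>. F (\<sigma>(k := u)) (\<sigma> k))) = sum ?f (UNIV \<times> ?P)"
    by (simp add: signed_sum_def sum.cartesian_product)
  also have "UNIV \<times> ?P = ?A \<union> ?B" by auto
  also have "sum ?f (?A \<union> ?B) = sum ?f ?A + sum ?f ?B"
  proof (rule sum.union_disjoint)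
    have "finite ((UNIV :: 7 set) \<times> ?P)" by (rule finite_cartesian_product[OF finite fin])
    then show "finite ?A" "finite ?B" by (auto elim: rev_finite_subset)
  qed auto
  also have "sum ?f ?A = signed_sum (\<lambda>\<sigma>. F \<sigma> u)"
    unfolding signed_sum_def
  proof (rule sum.reindex_bij_witness[of _ "\<lambda>\<sigma>. (inv \<sigma> u, \<sigma>)" snd], goal_cases)
    case (1 a) then show ?case by (auto simp: permutes_inverses)
  next
    case (2 a) then show ?case by auto
  next
    case (3 b) then show ?case by auto
  next
    case (4 b) then show ?case by (auto simp: permutes_inverses)
  next
    case (5 a) then show ?case by (auto simp: fun_upd_idem)
  qed
  also have "sum ?f ?B = 0"
  proof -
    have "sum ?f ?B = sum (\<lambda>x. - ?f x) ?B"
    proof (rule sum.reindex_bij_witness[of _ ?h ?h])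
      fix x assume "x \<in> ?B"
      then obtain k \<sigma> where x: "x = (k, \<sigma>)" and p: "\<sigma> permutes UNIV" and ne: "\<sigma> k \<noteq> u" by auto
      define l where "l = inv \<sigma> u"
      define \<tau> where "\<tau> = \<sigma> \<circ> Transposition.transpose k l"
      have l: "\<sigma> l = u" using p by (simp add: l_def permutes_inverses)
      then have kl: "k \<noteq> l" using ne by auto
      have \<tau>: "\<tau> permutes UNIV" using p by (auto simp: \<tau>_def permutes_compose permutes_swap_id)
      have hx: "?h x = (l, \<tau>)" by (simp add: x l_def \<tau>_def)
      have tk: "\<tau> k = u" "\<tau> l = \<sigma> k" using l by (auto simp: \<tau>_def)
      have il: "inv \<tau> u = k" using tk(1) \<tau> by (metis permutes_inverses(2))
      have "\<tau> \<circ> Transposition.transpose l k = \<sigma>"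
        by (simp add: \<tau>_def o_assoc[symmetric] transpose_commute)
      then show "?h (?h x) = x" unfolding hx by (simp add: il x)
      show "?h (?h x) = x" by fact
      show "?h x \<in> ?B" unfolding hx using \<tau> tk ne by simp
      show "?h x \<in> ?B" by fact
      have "sign \<tau> = - sign \<sigma>" unfolding \<tau>_def
        using p kl by (simp add: sign_compose permutation_swap_id sign_swap_id
            permutes_imp_permutation[OF finite])
      moreover have "\<tau>(l := u) = \<sigma>(k := u)"
        using l kl by (auto simp: \<tau>_def fun_eq_iff Transposition.transpose_def)
      ultimately show "- ?f (?h x) = ?f x" unfolding hx by (simp add: x tk)
    qed
    then show ?thesis by (simp add: sum_negf)
  qed
  finally show ?thesis by (simp only: add_0_right)
qed

section \<open>Linearity of signed sums and the trilinear expression behind the metric\<close>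

lemma signed_sum_add: "signed_sum (\<lambda>\<sigma>. F \<sigma> + G \<sigma>) = signed_sum F + signed_sum G"
  by (simp add: signed_sum_def distrib_left sum.distrib)

lemma signed_sum_minus: "signed_sum (\<lambda>\<sigma>. - F \<sigma>) = - signed_sum F"
  by (simp add: signed_sum_def sum_negf)

lemma signed_sum_cmult: "signed_sum (\<lambda>\<sigma>. c * F \<sigma>) = c * signed_sum F"
  by (simp add: signed_sum_def sum_distrib_left mult_ac)

lemma signed_sum_sum: "signed_sum (\<lambda>\<sigma>. \<Sum>i\<in>I. F i \<sigma>) = (\<Sum>i\<in>I. signed_sum (F i))"
  unfolding signed_sum_def by (simp add: sum_distrib_left) (rule sum.swap)

text \<open>By \<open>wedge223_axis\<close> this is four times the coefficient of the wedge product
  of \<open>\<alpha>\<close> contracted with the basis vector \<open>a\<close>,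
  \<open>\<beta>\<close> contracted with the basis vector \<open>b\<close>, and
  \<open>\<gamma>\<close>.\<close>

definition contr_dual :: "cov3 \<Rightarrow> cov3 \<Rightarrow> cov3 \<Rightarrow> cov2" where
  "contr_dual \<alpha> \<beta> \<gamma> a b = (\<Sum>m\<in>UNIV. \<Sum>n\<in>UNIV. \<Sum>p\<in>UNIV. \<Sum>q\<in>UNIV. \<alpha> a m n * \<beta> b p q * dual3 \<gamma> m n p q)"

lemma contr_dual_signed_sum:
  "contr_dual \<alpha> \<beta> \<gamma> a b = signed_sum (\<lambda>\<sigma>. \<alpha> a (\<sigma> 1) (\<sigma> 2) * \<beta> b (\<sigma> 3) (\<sigma> 4)
      * \<gamma> (\<sigma> 5) (\<sigma> 6) (\<sigma> 7)) / 6"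
  using signed_sum_slots[of 4 5 6 7 1 2 3 "\<lambda>m n p q x y z. \<alpha> a m n * \<beta> b p q * \<gamma> x y z"]
  unfolding contr_dual_def sum_dual3
  by (simp add: inj_tuple7 eps7_def sgn7_numerals mult_ac)

text \<open>2-forms commute: exchanging two pairs of slots is an even permutation.\<close>

lemma contr_dual_commute: "contr_dual \<alpha> \<beta> \<gamma> a b = contr_dual \<beta> \<alpha> \<gamma> b a"
  using signed_sum_slots[of 3 4 1 2 5 6 7 "\<lambda>m n p q x y z. \<beta> b m n * \<alpha> a p q * \<gamma> x y z"]
  unfolding contr_dual_signed_sum
  by (simp add: inj_tuple7 eps7_def sgn7_numerals mult_ac)

text \<open>The contraction with \<open>u\<close> of the vanishing 8-form \<open>(w \<lrcorner> \<alpha>) \<and> \<alpha> \<and> \<beta>\<close>, symmetrized in \<open>u\<close> and \<open>w\<close>.\<close>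

lemma contr_dual_exchange:
  assumes \<alpha>: "alternating3 \<alpha>" and \<beta>: "alternating3 \<beta>"
  shows "2 * contr_dual \<alpha> \<alpha> \<beta> w u = contr_dual \<alpha> \<beta> \<alpha> w u + contr_dual \<beta> \<alpha> \<alpha> w u"
proof -
  have A: "\<alpha> j i k = - \<alpha> i j k" "\<alpha> i k j = - \<alpha> i j k" for i j k
    using \<alpha> unfolding alternating3_def by (metis add.inverse_inverse)+
  have B: "\<beta> j i k = - \<beta> i j k" "\<beta> i k j = - \<beta> i j k" for i j k
    using \<beta> unfolding alternating3_def by (metis add.inverse_inverse)+
  define L where "L w u = signed_sum (\<lambda>\<sigma>. \<alpha> w (\<sigma> 1) (\<sigma> 2) * \<alpha> u (\<sigma> 3) (\<sigma> 4)
      * \<beta> (\<sigma> 5) (\<sigma> 6) (\<sigma> 7))" for w u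
  define R where "R w u = signed_sum (\<lambda>\<sigma>. \<alpha> w (\<sigma> 1) (\<sigma> 2) * \<beta> u (\<sigma> 3) (\<sigma> 4)
      * \<alpha> (\<sigma> 5) (\<sigma> 6) (\<sigma> 7))" for w u
  define M where "M w u = signed_sum (\<lambda>\<sigma>. \<alpha> w u (\<sigma> 1) * \<alpha> (\<sigma> 2) (\<sigma> 3) (\<sigma> 4)
      * \<beta> (\<sigma> 5) (\<sigma> 6) (\<sigma> 7))" for w u
  \<comment> \<open>Replacing slots 1 and 2 by \<open>u\<close> yields \<open>- M\<close> each,
    slots 3 and 4 yield \<open>- L\<close> each, and the three slots of \<open>\<beta>\<close> yield
    \<open>R\<close> each, so \<open>L = - 2 * M - 2 * L + 3 * R\<close>.\<close>
  have *: "3 * L w u = 3 * R w u - 2 * M w u" for w u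
  proof -
    let ?F = "\<lambda>\<sigma> u. \<alpha> w (\<sigma> 1) (\<sigma> 2) * \<alpha> u (\<sigma> 3) (\<sigma> 4) * \<beta> (\<sigma> 5) (\<sigma> 6) (\<sigma> 7)"
    let ?T = "\<lambda>k. signed_sum (\<lambda>\<sigma>. ?F (\<sigma>(k := u)) (\<sigma> k))"
    have "L w u = ?T 1 + ?T 2 + ?T 3 + ?T 4 + ?T 5 + ?T 6 + ?T 7"
      unfolding L_def signed_sum_replace[of ?F] sum_7 ..
    moreover have "?T 1 = - M w u"
    proof -
      have "?T 1 = signed_sum (\<lambda>\<sigma>. \<alpha> w u (\<sigma> 2) * \<alpha> (\<sigma> 1) (\<sigma> 3) (\<sigma> 4) * \<beta> (\<sigma> 5) (\<sigma> 6) (\<sigma> 7))"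
        by simp
      also have "\<dots> = - M w u"
        using signed_sum_slots[of 2 1 3 4 5 6 7 "\<lambda>a b c d e f g. \<alpha> w u a * \<alpha> b c d * \<beta> e f g"]
        by (simp add: inj_tuple7 eps7_def sgn7_numerals M_def)
      finally show ?thesis .
    qed
    moreover have "?T 2 = - M w u"
    proof -
      have "?T 2 = - signed_sum (\<lambda>\<sigma>. \<alpha> w u (\<sigma> 1) * \<alpha> (\<sigma> 2) (\<sigma> 3) (\<sigma> 4) * \<beta> (\<sigma> 5) (\<sigma> 6) (\<sigma> 7))"
        unfolding signed_sum_minus[symmetric] by (simp add: A(2)[of w _ u])
      then show ?thesis by (simp add: M_def)
    qed
    moreover have "?T 3 = - L w u"
      unfolding L_def signed_sum_minus[symmetric] by (simp add: A(1)[of _ u])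
    moreover have "?T 4 = - L w u"
    proof -
      have "?T 4 = signed_sum (\<lambda>\<sigma>. \<alpha> w (\<sigma> 1) (\<sigma> 2) * \<alpha> u (\<sigma> 4) (\<sigma> 3) * \<beta> (\<sigma> 5) (\<sigma> 6) (\<sigma> 7))"
        by (simp add: A(1)[of _ u] A(2)[of _ _ u])
      also have "\<dots> = - L w u"
        unfolding L_def signed_sum_minus[symmetric] by (subst A(2)) simp
      finally show ?thesis .
    qed
    moreover have "?T 5 = R w u"
    proof -
      have "?T 5 = signed_sum (\<lambda>\<sigma>. \<alpha> w (\<sigma> 1) (\<sigma> 2) * \<beta> u (\<sigma> 6) (\<sigma> 7) * \<alpha> (\<sigma> 5) (\<sigma> 3) (\<sigma> 4))"
        by (simp add: mult_ac)
      also have "\<dots> = R w u"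
        using signed_sum_slots[of 1 2 6 7 5 3 4 "\<lambda>a b c d e f g. \<alpha> w a b * \<beta> u c d * \<alpha> e f g"]
        by (simp add: inj_tuple7 eps7_def sgn7_numerals R_def)
      finally show ?thesis .
    qed
    moreover have "?T 6 = R w u"
    proof -
      have "?T 6 = - signed_sum (\<lambda>\<sigma>. \<alpha> w (\<sigma> 1) (\<sigma> 2) * \<beta> u (\<sigma> 5) (\<sigma> 7) * \<alpha> (\<sigma> 6) (\<sigma> 3) (\<sigma> 4))"
        unfolding signed_sum_minus[symmetric] by (simp add: mult_ac B(1)[of _ u])
      also have "\<dots> = R w u"
        using signed_sum_slots[of 1 2 5 7 6 3 4 "\<lambda>a b c d e f g. \<alpha> w a b * \<beta> u c d * \<alpha> e f g"]
        by (simp add: inj_tuple7 eps7_def sgn7_numerals R_def)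
      finally show ?thesis .
    qed
    moreover have "?T 7 = R w u"
    proof -
      have "?T 7 = signed_sum (\<lambda>\<sigma>. \<alpha> w (\<sigma> 1) (\<sigma> 2) * \<beta> u (\<sigma> 5) (\<sigma> 6) * \<alpha> (\<sigma> 7) (\<sigma> 3) (\<sigma> 4))"
        by (simp add: mult_ac B(2)[of _ _ u] B(1)[of _ u])
      also have "\<dots> = R w u"
        using signed_sum_slots[of 1 2 5 6 7 3 4 "\<lambda>a b c d e f g. \<alpha> w a b * \<beta> u c d * \<alpha> e f g"]
        by (simp add: inj_tuple7 eps7_def sgn7_numerals R_def)
      finally show ?thesis .
    qed
    ultimately show ?thesis by linarith
  qed
  \<comment> \<open>\<open>M\<close> is antisymmetric in its arguments, so symmetrizing removes
    it.\<close>
  have "M w u + M u w = 0"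
    unfolding M_def signed_sum_add[symmetric] by (simp add: A(1)[of u w] signed_sum_def)
  moreover have "L w u = L u w"
    using contr_dual_commute[of \<alpha> \<alpha> \<beta> w u] by (simp add: L_def contr_dual_signed_sum)
  moreover have "signed_sum (\<lambda>\<sigma>. \<beta> w (\<sigma> 1) (\<sigma> 2) * \<alpha> u (\<sigma> 3) (\<sigma> 4) * \<alpha> (\<sigma> 5) (\<sigma> 6) (\<sigma> 7)) = R u w"
    using contr_dual_commute[of \<beta> \<alpha> \<alpha> w u] by (simp add: R_def contr_dual_signed_sum)
  ultimately show ?thesis
    using *[of w u] *[of u w] by (simp add: contr_dual_signed_sum R_def[symmetric] L_def[symmetric])
qed

subsection \<open>Linear changes of frame\<close>

text \<open>The action of a matrix on every index, defined rank by rank so that each rank reduces to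
  the one below. Upper indices are moved by a matrix, lower ones by the transpose of its
  inverse.\<close>

definition push1 :: "real^7^7 \<Rightarrow> (7 \<Rightarrow> real) \<Rightarrow> 7 \<Rightarrow> real" where
  "push1 Q w i = (\<Sum>a\<in>UNIV. Q$i$a * w a)"

definition push2 :: "real^7^7 \<Rightarrow> cov2 \<Rightarrow> cov2" where
  "push2 Q w i j = (\<Sum>a\<in>UNIV. Q$i$a * push1 Q (w a) j)"

definition push3 :: "real^7^7 \<Rightarrow> cov3 \<Rightarrow> cov3" where
  "push3 Q w i j k = (\<Sum>a\<in>UNIV. Q$i$a * push2 Q (w a) j k)"

definition push4 :: "real^7^7 \<Rightarrow> cov4 \<Rightarrow> cov4" where
  "push4 Q w i j k l = (\<Sum>a\<in>UNIV. Q$i$a * push3 Q (w a) j k l)"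

lemma push2_flat: "push2 Q w i j = (\<Sum>a\<in>UNIV. \<Sum>b\<in>UNIV. Q$i$a * Q$j$b * w a b)"
  by (simp add: push2_def push1_def sum_distrib_left mult.assoc)

lemma push3_flat: "push3 Q w i j k = (\<Sum>a\<in>UNIV. \<Sum>b\<in>UNIV. \<Sum>c\<in>UNIV. Q$i$a * Q$j$b * Q$k$c * w a b c)"
  by (simp add: push3_def push2_flat sum_distrib_left mult.assoc)

lemma push4_flat: "push4 Q w i j k l =
  (\<Sum>a\<in>UNIV. \<Sum>b\<in>UNIV. \<Sum>c\<in>UNIV. \<Sum>d\<in>UNIV. Q$i$a * Q$j$b * Q$k$c * Q$l$d * w a b c d)"
  by (simp add: push4_def push3_flat sum_distrib_left mult.assoc)

lemma raise_eq_push: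
  "raise23 G \<omega> a = push2 (matrix_inv G) (\<omega> a)"
  "raise123 G \<omega> = push3 (matrix_inv G) \<omega>"
  "raise1234 G \<psi> = push4 (matrix_inv G) \<psi>"
  by (simp_all add: fun_eq_iff raise23_def raise123_def raise1234_def push2_flat push3_flat
      push4_flat)

lemma pullback3_eq_push: "pullback3 P \<omega> = push3 (transpose P) \<omega>"
  by (simp add: fun_eq_iff pullback3_def push3_flat transpose_def)

lemma push1_sum: "push1 Q (\<lambda>j. \<Sum>a\<in>UNIV. c a * f a j) i = (\<Sum>a\<in>UNIV. c a * push1 Q (f a) i)"
  unfolding push1_def sum_distrib_left
  by (subst sum.swap) (simp add: mult_ac)

lemma push2_sum: "push2 Q (\<lambda>j k. \<Sum>a\<in>UNIV. c a * f a j k) i j = (\<Sum>a\<in>UNIV. c a * push2 Q (f a) i j)"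
  unfolding push2_def push1_sum sum_distrib_left
  by (subst sum.swap) (simp add: mult_ac)

lemma push3_sum: "push3 Q (\<lambda>j k l. \<Sum>a\<in>UNIV. c a * f a j k l) i j k
    = (\<Sum>a\<in>UNIV. c a * push3 Q (f a) i j k)"
  unfolding push3_def push2_sum sum_distrib_left
  by (subst sum.swap) (simp add: mult_ac)

lemma matrix_inv_eqI:
  fixes A B :: "real^'n^'n"
  assumes "A ** B = mat 1" "B ** A = mat 1"
  shows "matrix_inv A = B"
proof -
  have "A ** matrix_inv A = mat 1 \<and> matrix_inv A ** A = mat 1"
    unfolding matrix_inv_def by (rule someI[of _ B]) (use assms in blast)
  then have "matrix_inv A = matrix_inv A ** (A ** B)" "matrix_inv A ** A = mat 1"
    using assms by simp_all
  then show ?thesis by (metis matrix_mul_assoc matrix_mul_lid)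
qed

lemma sum_matrix_mult:
  "(\<Sum>a\<in>UNIV. A$i$a * (\<Sum>b\<in>UNIV. B$a$b * f b)) = (\<Sum>b\<in>UNIV. (A ** B)$i$b * f b)"
  for A B :: "real^7^7"
  unfolding sum_distrib_left matrix_matrix_mult_def
  by (subst sum.swap) (simp add: sum_distrib_right mult.assoc)

lemma push1_push1: "push1 A (push1 B w) = push1 (A ** B) w"
  unfolding push1_def sum_matrix_mult ..

lemma push2_push2: "push2 A (push2 B w) = push2 (A ** B) w"
proof (intro ext)
  fix i j
  have "push2 A (push2 B w) i j = (\<Sum>a\<in>UNIV. A$i$a * (\<Sum>b\<in>UNIV. B$a$b * push1 (A ** B) (w b) j))"
    unfolding push2_def[of A] push2_def[of B, abs_def] push1_sum push1_push1[symmetric] ..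
  then show "push2 A (push2 B w) i j = push2 (A ** B) w i j"
    by (simp only: sum_matrix_mult push2_def)
qed

lemma push3_push3: "push3 A (push3 B w) = push3 (A ** B) w"
proof (intro ext)
  fix i j k
  have "push3 A (push3 B w) i j k = (\<Sum>a\<in>UNIV. A$i$a * (\<Sum>b\<in>UNIV. B$a$b * push2 (A ** B) (w b) j k))"
    unfolding push3_def[of A] push3_def[of B, abs_def] push2_sum push2_push2[symmetric] ..
  then show "push3 A (push3 B w) i j k = push3 (A ** B) w i j k"
    by (simp only: sum_matrix_mult push3_def)
qed

lemma push4_push4: "push4 A (push4 B w) = push4 (A ** B) w"
proof (intro ext)
  fix i j k l
  have "push4 A (push4 B w) i j k l = (\<Sum>a\<in>UNIV. A$i$a * (\<Sum>b\<in>UNIV. B$a$b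
      * push3 (A ** B) (w b) j k l))"
    unfolding push4_def[of A] push4_def[of B, abs_def] push3_sum push3_push3[symmetric] ..
  then show "push4 A (push4 B w) i j k l = push4 (A ** B) w i j k l"
    by (simp only: sum_matrix_mult push4_def)
qed

lemma push_mat_1:
  "push1 (mat 1) w1 = w1" "push2 (mat 1) w2 = w2" "push3 (mat 1) w3 = w3" "push4 (mat 1) w4 = w4"
  by (simp_all add: push1_def push2_def push3_def push4_def fun_eq_iff mat_def
      if_distrib[where f="\<lambda>t. t * _"] cong: if_cong)

section \<open>Invariance of contractions and equivariance of the dual\<close>

lemma contract_push1:
  fixes A B :: "real^7^7"
  assumes "transpose A ** B = mat 1"
  shows "(\<Sum>c\<in>UNIV. (\<Sum>j\<in>UNIV. A$c$j * x j) * (\<Sum>j\<in>UNIV. B$c$j * y j)) = (\<Sum>j\<in>UNIV. x j * y j)"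
proof -
  have "(\<Sum>c\<in>UNIV. (\<Sum>j\<in>UNIV. A$c$j * x j) * (\<Sum>j\<in>UNIV. B$c$j * y j))
    = (A *v (\<chi> j. x j)) \<bullet> (B *v (\<chi> j. y j))"
    by (simp add: inner_vec_def matrix_vector_mult_def)
  also have "\<dots> = (\<chi> j. x j) \<bullet> ((transpose A ** B) *v (\<chi> j. y j))"
    by (metis dot_lmul_matrix vector_transpose_matrix matrix_vector_mul_assoc)
  also have "\<dots> = (\<Sum>j\<in>UNIV. x j * y j)"
    unfolding assms by (simp add: inner_vec_def)
  finally show ?thesis .
qed

lemma contract_push2:
  assumes "transpose A ** B = mat 1"
  shows "(\<Sum>c\<in>UNIV. \<Sum>d\<in>UNIV. push2 A X c d * push2 B Y c d) = (\<Sum>c\<in>UNIV. \<Sum>d\<in>UNIV. X c d * Y c d)"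
  unfolding push2_def
  apply (subst sum.swap)
  apply (subst contract_push1[OF assms])
  apply (subst sum.swap)
  unfolding push1_def
  apply (subst contract_push1[OF assms])
  ..

lemma contract_push3:
  assumes "transpose A ** B = mat 1"
  shows "(\<Sum>b\<in>UNIV. \<Sum>c\<in>UNIV. \<Sum>d\<in>UNIV. push3 A X b c d * push3 B Y b c d)
    = (\<Sum>b\<in>UNIV. \<Sum>c\<in>UNIV. \<Sum>d\<in>UNIV. X b c d * Y b c d)"
proof -
  \<comment> \<open>The index of the first slot is moved innermost, where
    \<open>contract_push1\<close> can act on it.\<close>
  have "(\<Sum>b\<in>UNIV. \<Sum>c\<in>UNIV. \<Sum>d\<in>UNIV. push3 A X b c d * push3 B Y b c d)
     = (\<Sum>c\<in>UNIV. \<Sum>d\<in>UNIV. \<Sum>b\<in>UNIV. push3 A X b c d * push3 B Y b c d)"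
    by (subst sum.swap) (rule sum.cong[OF refl], rule sum.swap)
  also have "\<dots> = (\<Sum>c\<in>UNIV. \<Sum>d\<in>UNIV. \<Sum>b\<in>UNIV. push2 A (X b) c d * push2 B (Y b) c d)"
    unfolding push3_def contract_push1[OF assms] ..
  also have "\<dots> = (\<Sum>b\<in>UNIV. \<Sum>c\<in>UNIV. \<Sum>d\<in>UNIV. push2 A (X b) c d * push2 B (Y b) c d)"
    by (subst (2) sum.swap) (rule sum.cong[OF refl], rule sum.swap)
  finally show ?thesis unfolding contract_push2[OF assms] .
qed

text \<open>Seven copies of \<open>Q\<close> contracted with the Levi-Civita symbol give
  \<open>det Q\<close> times the symbol; three of the copies come from the form, four from the
  dual.\<close>

lemma dual3_push:
  "push4 Q (dual3 (push3 (transpose Q) \<omega>)) e f g h = det Q * dual3 \<omega> e f g h"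
proof -
  have "push4 Q (dual3 (push3 (transpose Q) \<omega>)) e f g h =
    signed_sum (\<lambda>\<sigma>. push3 (transpose Q) \<omega> (\<sigma> 1) (\<sigma> 2) (\<sigma> 3) *
       (Q$e$\<sigma> 4 * Q$f$\<sigma> 5 * Q$g$\<sigma> 6 * Q$h$\<sigma> 7)) / 6"
    unfolding push4_flat by (rule sum_dual3)
  also have "signed_sum (\<lambda>\<sigma>. push3 (transpose Q) \<omega> (\<sigma> 1) (\<sigma> 2) (\<sigma> 3) *
       (Q$e$\<sigma> 4 * Q$f$\<sigma> 5 * Q$g$\<sigma> 6 * Q$h$\<sigma> 7)) =
     signed_sum (\<lambda>\<sigma>. \<Sum>a\<in>UNIV. \<Sum>b\<in>UNIV. \<Sum>c\<in>UNIV. \<omega> a b c *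
      (Q$a$\<sigma> 1 * Q$b$\<sigma> 2 * Q$c$\<sigma> 3 * Q$e$\<sigma> 4 * Q$f$\<sigma> 5 * Q$g$\<sigma> 6 * Q$h$\<sigma> 7))"
    by (simp only: push3_flat transpose_def vec_lambda_beta sum_distrib_right) (simp only: mult_ac)
  also have "\<dots> = 6 * (det Q * dual3 \<omega> e f g h)"
    unfolding signed_sum_sum signed_sum_cmult signed_sum_det dual3_def
    by (simp add: sum_distrib_left mult_ac)
  finally show ?thesis by simp
qed

lemma push4_cmult: "push4 Q (\<lambda>i j k l. c * w i j k l) = (\<lambda>i j k l. c * push4 Q w i j k l)"
  by (simp add: fun_eq_iff push4_flat sum_distrib_left mult_ac)

lemma dual3_push_transpose:
  assumes "R ** P = mat 1" "P ** R = mat 1"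
  shows "dual3 (push3 (transpose P) \<omega>) = (\<lambda>i j k l. det P * push4 R (dual3 \<omega>) i j k l)"
proof -
  let ?X = "dual3 (push3 (transpose P) \<omega>)"
  have "push4 P ?X = (\<lambda>i j k l. det P * dual3 \<omega> i j k l)"
    by (intro ext) (rule dual3_push)
  then have "push4 R (push4 P ?X) = push4 R (\<lambda>i j k l. det P * dual3 \<omega> i j k l)"
    by simp
  then show ?thesis
    by (simp add: push4_push4 assms push_mat_1 push4_cmult)
qed

text \<open>With \<open>K\<close> the inverse metric, \<open>dual3_push\<close> for the symmetric
  matrix \<open>K\<close> gives the factor \<open>v * det K\<close>, which is \<open>1 / v\<close>
  because \<open>v\<close> squares to \<open>det G\<close>.\<close>

lemma raise1234_hodge3:
  assumes "transpose G = G" "v\<^sup>2 = det G" "det G \<noteq> 0"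
  shows "raise1234 G (hodge3 G v \<omega>) = (\<lambda>i j k l. dual3 \<omega> i j k l / v)"
proof -
  obtain K where K: "G ** K = mat 1" "K ** G = mat 1"
    using assms(3) by (metis invertible_det_nz invertible_def)
  then have inv: "matrix_inv G = K" by (rule matrix_inv_eqI)
  have "transpose K = K"
  proof -
    have "transpose K ** G = mat 1"
      using K(1) assms(1) by (metis matrix_transpose_mul transpose_mat)
    then show ?thesis using K(1) by (metis matrix_mul_assoc matrix_mul_lid matrix_mul_rid)
  qed
  then have "raise1234 G (hodge3 G v \<omega>) = (\<lambda>i j k l. v * (det K * dual3 \<omega> i j k l))"
    using dual3_push[of K \<omega>] by (simp add: fun_eq_iff raise_eq_push inv hodge3_eq[abs_def]
        push4_cmult)
  moreover have "v * det K = 1 / v"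
  proof -
    have "det G * det K = 1" using K(1) by (metis det_mul det_I)
    moreover have "v * det K * v = v\<^sup>2 * det K" by (simp add: power2_eq_square)
    ultimately have "v * det K * v = 1" "v \<noteq> 0" using assms(2,3) by auto
    then show ?thesis by (simp add: eq_divide_eq)
  qed
  ultimately show ?thesis by (simp add: fun_eq_iff mult.assoc[symmetric])
qed

subsection \<open>Pointwise identities of a G2-structure\<close>

text \<open>On the summed indices \<open>P\<close> and its inverse cancel, so
  \<open>phi0_psi0\<close> applies; the free indices keep their frame matrices.\<close>

lemma sum_push3_push4:
  assumes "P ** R = mat 1"
  shows "(\<Sum>c\<in>UNIV. \<Sum>d\<in>UNIV. push3 (transpose P) phi0 e c d * push4 R psi0 m b c d)
     = 4 * (\<Sum>i\<in>UNIV. P$i$e * push2 R (phi0 i) m b)"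
proof -
  have c: "(\<Sum>c\<in>UNIV. \<Sum>d\<in>UNIV. push2 (transpose P) X c d * push2 R Y c d)
      = (\<Sum>c\<in>UNIV. \<Sum>d\<in>UNIV. X c d * Y c d)" for X Y
    by (rule contract_push2) (simp add: assms)
  have "push4 R psi0 m b = (\<lambda>c d. \<Sum>p\<in>UNIV. R$m$p * (\<Sum>q\<in>UNIV. R$b$q * push2 R (psi0 p q) c d))"
    by (simp add: fun_eq_iff push4_def push3_def)
  then have "(\<Sum>c\<in>UNIV. \<Sum>d\<in>UNIV. push3 (transpose P) phi0 e c d * push4 R psi0 m b c d)
    = (\<Sum>i\<in>UNIV. \<Sum>p\<in>UNIV. transpose P$e$i * R$m$p * (\<Sum>q\<in>UNIV. R$b$q * (4 * phi0 i p q)))"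
    unfolding push3_def by (simp only: sum_bilinear2 sum_linear2 c phi0_psi0)
  then show ?thesis
    by (simp add: push2_def push1_def sum_distrib_left transpose_def mult_ac)
qed

lemma sum_push4_push4:
  assumes "R ** P = mat 1" "P ** R = mat 1"
  shows "(\<Sum>b\<in>UNIV. \<Sum>c\<in>UNIV. \<Sum>d\<in>UNIV. push4 (transpose P) psi0 e b c d * push4 R psi0 m b c d)
     = 24 * of_bool (e = m)"
proof -
  have c: "(\<Sum>b\<in>UNIV. \<Sum>c\<in>UNIV. \<Sum>d\<in>UNIV. push3 (transpose P) X b c d * push3 R Y b c d)
    = (\<Sum>b\<in>UNIV. \<Sum>c\<in>UNIV. \<Sum>d\<in>UNIV. X b c d * Y b c d)" for X Y
    by (rule contract_push3) (simp add: assms)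
  have "(\<Sum>b\<in>UNIV. \<Sum>c\<in>UNIV. \<Sum>d\<in>UNIV. push4 (transpose P) psi0 e b c d * push4 R psi0 m b c d)
    = (\<Sum>i\<in>UNIV. \<Sum>p\<in>UNIV. transpose P$e$i * R$m$p * (24 * of_bool (i = p)))"
    unfolding push4_def by (simp only: sum_bilinear3 c psi0_psi0)
  also have "\<dots> = 24 * (\<Sum>i\<in>UNIV. R$m$i * P$i$e)"
    by (simp add: sum_distrib_left transpose_def mult_ac of_bool_def if_distrib[where f="\<lambda>t. _ * t"]
        if_distrib[where f="\<lambda>t. t * _"] cong: if_cong)
  also have "\<dots> = 24 * (R ** P)$m$e"
    by (simp add: matrix_matrix_mult_def)
  finally show ?thesis by (simp add: assms mat_def of_bool_def eq_commute)
qed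

lemma wedge223_axis:
  "wedge223 (interior3 (axis a 1) \<alpha>) (interior3 (axis b 1) \<beta>) \<gamma> = contr_dual \<alpha> \<beta> \<gamma> a b / 4"
proof -
  have "interior3 (axis a 1) \<alpha> = \<alpha> a" for a \<alpha>
    by (simp add: interior3_def fun_eq_iff axis_def if_distrib[where f="\<lambda>t. t * _"] cong: if_cong)
  then show ?thesis by (simp add: wedge223_eq contr_dual_def)
qed

text \<open>The 24 is the product of the 4 in \<open>phi0_psi0\<close> and the 6 in
  \<open>phi0_phi0\<close>; the determinant enters through the dual.\<close>

lemma contr_dual_pullback_phi0:
  assumes "R ** P = mat 1" "P ** R = mat 1" "\<phi> = pullback3 P phi0"
  shows "contr_dual \<phi> \<phi> \<phi> a b = 24 * det P * (transpose P ** P)$a$b"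
proof -
  have \<phi>: "\<phi> = push3 (transpose P) phi0" using assms pullback3_eq_push by metis
  have d: "dual3 \<phi> = (\<lambda>i j k l. det P * push4 R psi0 i j k l)"
    unfolding \<phi> by (simp add: dual3_push_transpose[OF assms(1,2)] dual3_phi0)
  have c: "(\<Sum>c\<in>UNIV. \<Sum>d\<in>UNIV. push2 (transpose P) X c d * push2 R Y c d)
      = (\<Sum>c\<in>UNIV. \<Sum>d\<in>UNIV. X c d * Y c d)" for X Y
    by (rule contract_push2) (simp add: assms)
  have "contr_dual \<phi> \<phi> \<phi> a b = det P * (\<Sum>m\<in>UNIV. \<Sum>n\<in>UNIV. \<phi> a m n *
       (\<Sum>p\<in>UNIV. \<Sum>q\<in>UNIV. push3 (transpose P) phi0 b p q * push4 R psi0 m n p q))"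
    unfolding contr_dual_def d unfolding \<phi> by (simp add: sum_distrib_left mult_ac)
  also have "\<dots> = 4 * det P * (\<Sum>m\<in>UNIV. \<Sum>n\<in>UNIV. \<phi> a m n *
       (\<Sum>i\<in>UNIV. P$i$b * push2 R (phi0 i) m n))"
    unfolding sum_push3_push4[OF assms(2)] by (simp add: sum_distrib_left mult_ac)
  also have "(\<Sum>m\<in>UNIV. \<Sum>n\<in>UNIV. \<phi> a m n * (\<Sum>i\<in>UNIV. P$i$b * push2 R (phi0 i) m n))
     = (\<Sum>j\<in>UNIV. \<Sum>i\<in>UNIV. transpose P$a$j * P$i$b * (6 * of_bool (j = i)))"
    unfolding \<phi> push3_def by (simp only: sum_bilinear2 c phi0_phi0)
  also have "\<dots> = 6 * (transpose P ** P)$a$b"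
    by (simp add: matrix_matrix_mult_def sum_distrib_left mult_ac of_bool_def
        if_distrib[where f="\<lambda>t. _ * t"]
        if_distrib[where f="\<lambda>t. t * _"] cong: if_cong)
  finally show ?thesis by simp
qed

lemma power_eq_odd_real:
  fixes a b :: real
  assumes "a ^ n = b ^ n" "odd n"
  shows "a = b"
  using assms odd_real_root_power_cancel by metis

text \<open>Taking determinants in \<open>v G = det P (transpose P ** P)\<close> gives \<open>v\<^sup>9 = (det P)\<^sup>9\<close>.\<close>

lemma g2_normal_form:
  fixes G :: "real^7^7"
  assumes pos: "positive3 \<phi>" and v: "v\<^sup>2 = det G" "v \<noteq> 0"
    and G: "\<And>u w. (u \<bullet> (G *v w)) * v = 1 / 6 * wedge223 (interior3 u \<phi>) (interior3 w \<phi>) \<phi>"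
  obtains P R where "R ** P = mat 1" "P ** R = mat 1" "\<phi> = push3 (transpose P) phi0"
    "det P = v" "G = transpose P ** P"
proof -
  obtain P where P: "invertible P" "\<phi> = pullback3 P phi0"
    using pos unfolding positive3_def by blast
  then obtain R where R: "R ** P = mat 1" "P ** R = mat 1"
    unfolding invertible_def by blast
  \<comment> \<open>Evaluation on basis vectors; the 24 of the previous lemma cancels against the 6
    in the definition of the metric and the 4 in \<open>wedge223_axis\<close>.\<close>
  have e: "v *\<^sub>R G = det P *\<^sub>R (transpose P ** P)"
  proof -
    have "v * G$a$b = det P * (transpose P ** P)$a$b" for a b
    proof -
      have "axis a 1 \<bullet> (G *v axis b 1) = G$a$b"
        by (simp add: inner_axis' matrix_vector_mul_component inner_axis)
      then show ?thesis
        using G[of "axis a 1" "axis b 1"] contr_dual_pullback_phi0[OF R P(2), of a b]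
        by (simp add: wedge223_axis mult_ac)
    qed
    then show ?thesis by (simp add: vec_eq_iff)
  qed
  have "det (c *\<^sub>R A) = c ^ 7 * det A" for c and A :: "real^7^7"
    using det_rows_mul[of "\<lambda>_. c" "\<lambda>i. A$i"] by (simp add: scalar_mult_eq_scaleR scaleR_vec_def)
  then have "v ^ 7 * v\<^sup>2 = det P ^ 7 * (det P * det P)"
    using arg_cong[OF e, of det] by (simp add: v det_mul)
  then have "v ^ 9 = det P ^ 9" by (simp add: eval_nat_numeral mult_ac)
  then have vP: "det P = v" by (metis power_eq_odd_real odd_numeral)
  then have "G = transpose P ** P" using e v(2) by simp
  then show ?thesis
    using that R P(2) vP pullback3_eq_push by metis
qed

text \<open>The part of \<open>g2_structure\<close> used at a single point; nondegeneracy of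
  \<open>G\<close> is recorded as \<open>v \<noteq> 0\<close>.\<close>

definition g2_at :: "cov3 \<Rightarrow> real^7^7 \<Rightarrow> real \<Rightarrow> bool" where
  "g2_at \<phi> G v \<longleftrightarrow> positive3 \<phi> \<and> alternating3 \<phi> \<and> transpose G = G \<and> v\<^sup>2 = det G \<and> v \<noteq> 0 \<and>
     (\<forall>u w. (u \<bullet> (G *v w)) * v = 1 / 6 * wedge223 (interior3 u \<phi>) (interior3 w \<phi>) \<phi>)"

lemma g2_at_normal_form:
  assumes "g2_at \<phi> G v"
  obtains P R where "R ** P = mat 1" "P ** R = mat 1" "\<phi> = push3 (transpose P) phi0"
    "det P = v" "G = transpose P ** P" "dual3 \<phi> = (\<lambda>i j k l. v * push4 R psi0 i j k l)"
    "matrix_inv G = R ** transpose R"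
proof -
  obtain P R where P: "R ** P = mat 1" "P ** R = mat 1" "\<phi> = push3 (transpose P) phi0"
    "det P = v" "G = transpose P ** P"
    using assms unfolding g2_at_def by (blast intro: g2_normal_form)
  have d: "dual3 \<phi> = (\<lambda>i j k l. v * push4 R psi0 i j k l)"
    unfolding P(3) by (simp add: dual3_push_transpose[OF P(1,2)] dual3_phi0 P(4))
  have t: "transpose P ** transpose R = mat 1" "transpose R ** transpose P = mat 1"
    by (simp_all add: P matrix_transpose_mul[symmetric])
  have "matrix_inv G = R ** transpose R"
  proof (rule matrix_inv_eqI)
    show "G ** (R ** transpose R) = mat 1"
      unfolding P(5) by (metis P(2) t(1) matrix_mul_assoc matrix_mul_lid)
    show "R ** transpose R ** G = mat 1"
      unfolding P(5) by (metis P(1) t(2) matrix_mul_assoc matrix_mul_lid)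
  qed
  then show ?thesis using that P d by blast
qed

text \<open>\<open>phi0_psi0\<close> transported by the frame \<open>P\<close>; the dual without a
  metric contributes the factor \<open>v\<close>.\<close>

lemma g2_at_contract_dual:
  assumes "g2_at \<phi> G v"
  shows "(\<Sum>c\<in>UNIV. \<Sum>d\<in>UNIV. \<phi> e c d * dual3 \<phi> m b c d) = 4 * v * raise23 G \<phi> e m b"
proof -
  obtain P R where P: "R ** P = mat 1" "P ** R = mat 1" "\<phi> = push3 (transpose P) phi0"
    "det P = v" "G = transpose P ** P" "dual3 \<phi> = (\<lambda>i j k l. v * push4 R psi0 i j k l)"
    "matrix_inv G = R ** transpose R"
    using g2_at_normal_form[OF assms] .
  \<comment> \<open>Raising an index with the inverse metric turns an index moved by
    \<open>transpose P\<close> into one moved by \<open>R\<close>.\<close>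
  have "R ** transpose R ** transpose P = R"
    by (metis P(2) matrix_mul_assoc matrix_mul_rid matrix_transpose_mul transpose_mat)
  moreover have "\<phi> e = (\<lambda>j k. \<Sum>i\<in>UNIV. P$i$e * push2 (transpose P) (phi0 i) j k)"
    by (simp add: P(3) push3_def transpose_def fun_eq_iff)
  ultimately have "raise23 G \<phi> e m b = (\<Sum>i\<in>UNIV. P$i$e * push2 R (phi0 i) m b)"
    by (simp only: raise_eq_push P(7) push2_sum push2_push2)
  then show ?thesis
    using sum_push3_push4[OF P(2), of e m b]
    by (simp add: P(6) mult.left_commute[of _ v] sum_distrib_left[symmetric] P(3)[symmetric])
qed

text \<open>\<open>psi0_psi0\<close> transported by the frame: the Hodge dual has its indices moved
  by \<open>transpose P\<close>, the dual without a metric by \<open>R\<close>, up to the factor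
  \<open>v\<close>.\<close>

lemma g2_at_contract_hodge_dual:
  assumes "g2_at \<phi> G v"
  shows "(\<Sum>b\<in>UNIV. \<Sum>c\<in>UNIV. \<Sum>d\<in>UNIV. hodge3 G v \<phi> e b c d * dual3 \<phi> m b c d) = 24 * v * of_bool (e
      = m)"
proof -
  obtain P R where P: "R ** P = mat 1" "P ** R = mat 1" "\<phi> = push3 (transpose P) phi0"
    "det P = v" "G = transpose P ** P" "dual3 \<phi> = (\<lambda>i j k l. v * push4 R psi0 i j k l)"
    "matrix_inv G = R ** transpose R"
    using g2_at_normal_form[OF assms] .
  have "R ** transpose R ** transpose P = R"
    by (metis P(2) matrix_mul_assoc matrix_mul_rid matrix_transpose_mul transpose_mat)
  then have r: "raise123 G \<phi> = push3 R phi0"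
    by (simp only: raise_eq_push P(3,7) push3_push3)
  have t: "transpose P ** transpose R = mat 1" "transpose R ** transpose P = mat 1"
    by (simp_all add: P matrix_transpose_mul[symmetric])
  have "v * det R = 1" using P(2,4) by (metis det_mul det_I)
  then have "hodge3 G v \<phi> = push4 (transpose P) psi0"
    using dual3_push_transpose[OF t, of phi0]
    by (simp add: fun_eq_iff hodge3_eq r dual3_phi0 mult.assoc[symmetric])
  then show ?thesis
    using sum_push4_push4[OF P(1,2), of e m]
    by (simp add: P(6) mult.left_commute[of _ v] sum_distrib_left[symmetric])
qed

lemma contr_dual_self:
  assumes "g2_at \<phi> G v"
  shows "contr_dual \<phi> \<phi> \<phi> a b = 24 * v * G$a$b"
proof -
  have "axis a 1 \<bullet> (G *v axis b 1) = G$a$b"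
    by (simp add: inner_axis' matrix_vector_mul_component inner_axis)
  moreover have "(axis a 1 \<bullet> (G *v axis b 1)) * v
      = 1 / 6 * wedge223 (interior3 (axis a 1) \<phi>) (interior3 (axis b 1) \<phi>) \<phi>"
    using assms unfolding g2_at_def by blast
  ultimately show ?thesis by (simp add: wedge223_axis mult_ac)
qed

section \<open>The deformed metric\<close>

lemma contr_dual_add:
  "contr_dual (\<lambda>i j k. \<alpha> i j k + \<alpha>' i j k) \<beta> \<gamma> a b = contr_dual \<alpha> \<beta> \<gamma> a b + contr_dual \<alpha>' \<beta> \<gamma> a b"
  "contr_dual \<alpha> (\<lambda>i j k. \<beta> i j k + \<beta>' i j k) \<gamma> a b = contr_dual \<alpha> \<beta> \<gamma> a b + contr_dual \<alpha> \<beta>' \<gamma> a b"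
  "contr_dual \<alpha> \<beta> (\<lambda>i j k. \<gamma> i j k + \<gamma>' i j k) a b = contr_dual \<alpha> \<beta> \<gamma> a b + contr_dual \<alpha> \<beta> \<gamma>' a b"
  unfolding contr_dual_signed_sum by (simp_all
      add: signed_sum_add[symmetric] algebra_simps add_divide_distrib[symmetric])

text \<open>Both sides times \<open>24 * v\<close> equal \<open>contr_dual\<close> with all three
  arguments \<open>\<phi>'\<close>. Of its eight terms, the three linear in \<open>chi\<close>
  combine to 3/2 of the two with \<open>chi\<close> in a contracted place, and the three quadratic
  ones to three times \<open>contr_dual chi chi \<phi>\<close>, both by
  \<open>contr_dual_exchange\<close>.\<close>

lemma s_tensor_eq:
  assumes \<phi>: "g2_at \<phi> G v" and \<phi>': "g2_at \<phi>' G' v'" and chi: "alternating3 chi"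
    and sum: "\<phi>' = (\<lambda>i j k. \<phi> i j k + chi i j k)"
  shows "s_tensor G v \<phi> chi a b = v' / v * G'$a$b"
proof -
  have G: "transpose G = G" "v\<^sup>2 = det G" "det G \<noteq> 0" and v: "v \<noteq> 0" and alt: "alternating3 \<phi>"
    using \<phi> unfolding g2_at_def by auto
  have "chi m n a = chi a m n" for a m n
    using chi unfolding alternating3_def by (metis add.inverse_inverse)
  then have cyc: "(\<Sum>m\<in>UNIV. \<Sum>n\<in>UNIV. chi m n a * X m n)
      = (\<Sum>m\<in>UNIV. \<Sum>n\<in>UNIV. chi a m n * X m n)" for a X
    by (intro sum.cong refl arg_cong2[where f=times])
  have lin: "contr_dual chi \<phi> \<phi> a b = 4 * v * (\<Sum>m\<in>UNIV. \<Sum>n\<in>UNIV. chi a m n * raise23 G \<phi> b m n)"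
      for a b
  proof -
    have "contr_dual chi \<phi> \<phi> a b = (\<Sum>m\<in>UNIV. \<Sum>n\<in>UNIV. chi a m n * (\<Sum>p\<in>UNIV. \<Sum>q\<in>UNIV. \<phi> b p q
        * dual3 \<phi> m n p q))"
      unfolding contr_dual_def by (simp add: sum_distrib_left mult_ac)
    then show ?thesis
      unfolding g2_at_contract_dual[OF \<phi>] by (simp add: sum_distrib_left mult_ac)
  qed
  have q: "(\<Sum>m\<in>UNIV. \<Sum>n\<in>UNIV. \<Sum>p\<in>UNIV. \<Sum>q\<in>UNIV. chi a m n * chi b p q
      * raise1234 G (hodge3 G v \<omega>) m n p q)
     = contr_dual chi chi \<omega> a b / v" for \<omega>
    unfolding raise1234_hodge3[OF G] contr_dual_def by (simp add: sum_divide_distrib)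
  \<comment> \<open>The 3/2 comes from the prefactor 1/2, the 1/2 of symmetrization and the 1/4 of
    \<open>lin\<close>: 24/16.\<close>
  have "v * s_tensor G v \<phi> chi a b = (24 * v * G$a$b + 3 / 2 * (contr_dual chi \<phi> \<phi> a b
      + contr_dual chi \<phi> \<phi> b a)
      + 3 * contr_dual chi chi \<phi> a b + contr_dual chi chi chi a b) / 24"
    unfolding s_tensor_def symmetrize2_def q lin cyc using v by (simp add: field_simps)
  also have "\<dots> = contr_dual \<phi>' \<phi>' \<phi>' a b / 24"
  proof -
    have "contr_dual \<phi>' \<phi>' \<phi>' a b = contr_dual \<phi> \<phi> \<phi> a b + contr_dual \<phi> \<phi> chi a b
      + contr_dual \<phi> chi \<phi> a b + contr_dual \<phi> chi chi a b + contr_dual chi \<phi> \<phi> a b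
      + contr_dual chi \<phi> chi a b + contr_dual chi chi \<phi> a b + contr_dual chi chi chi a b"
      by (simp add: sum contr_dual_add)
    then show ?thesis
      using contr_dual_exchange[OF alt chi, of a b] contr_dual_exchange[OF chi alt, of a b]
        contr_dual_commute[of chi \<phi> \<phi> b a] contr_dual_self[OF \<phi>, of a b] by (simp add: field_simps)
  qed
  also have "\<dots> = v' * G'$a$b"
    unfolding contr_dual_self[OF \<phi>'] by simp
  finally show ?thesis using v by (simp add: field_simps)
qed

subsection \<open>The difference of the Levi-Civita connections\<close>

lemma partial_eqI: "(f has_derivative D) (at x) \<Longrightarrow> partial i f x = D (axis i 1)"
  unfolding partial_def using frechet_derivative_at by metis

lemma has_derivative_frechet:
  "f differentiable (at x) \<Longrightarrow> (f has_derivative frechet_derivative f (at x)) (at x)"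
  by (rule frechet_derivative_works[THEN iffD1])

lemma partial_add:
  assumes "f differentiable (at x)" "g differentiable (at x)"
  shows "partial i (\<lambda>y. f y + g y) x = partial i f x + partial i g x"
  by (rule partial_eqI[OF has_derivative_add[OF assms[THEN has_derivative_frechet]], folded
      partial_def])

lemma partial_mult:
  assumes "f differentiable (at x)" "g differentiable (at x)"
  shows "partial i (\<lambda>y. f y * g y) x = f x * partial i g x + partial i f x * g x"
  by (rule partial_eqI[OF has_derivative_mult[OF assms[THEN has_derivative_frechet]], folded
      partial_def])

text \<open>Jacobi's formula: the derivative is the sum, over the rows, of the determinant with that
  row differentiated.\<close>

lemma partial_det:
  fixes G :: "real^7 \<Rightarrow> real^7^7"
  assumes diff: "\<And>i j. (\<lambda>y. G y $ i $ j) differentiable (at x)" and K: "K ** G x = mat 1"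
  shows "partial a (\<lambda>y. det (G y)) x
    = det (G x) * (\<Sum>m\<in>UNIV. \<Sum>n\<in>UNIV. K$m$n * partial a (\<lambda>y. G y $ n $ m) x)"
proof -
  let ?D = "\<chi> i j. partial a (\<lambda>y. G y $ i $ j) x :: real^7^7"
  let ?P = "{\<sigma>. \<sigma> permutes (UNIV :: 7 set)}"
  have "((\<lambda>y. \<Sum>\<sigma>\<in>?P. of_int (sign \<sigma>) * (\<Prod>i\<in>UNIV. G y $ i $ \<sigma> i)) has_derivative
     (\<lambda>h. \<Sum>\<sigma>\<in>?P. of_int (sign \<sigma>) * (\<Sum>i\<in>UNIV. frechet_derivative (\<lambda>y. G y $ i $ \<sigma> i) (at x) h
        * (\<Prod>j\<in>UNIV - {i}. G x $ j $ \<sigma> j)))) (at x)"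
    by (intro has_derivative_sum has_derivative_mult_right has_derivative_prod
        has_derivative_frechet diff)
  from partial_eqI[OF this, of a]
  have "partial a (\<lambda>y. det (G y)) x = (\<Sum>\<sigma>\<in>?P. \<Sum>i\<in>UNIV. of_int (sign \<sigma>) *
      (?D $ i $ \<sigma> i * (\<Prod>j\<in>UNIV - {i}. G x $ j $ \<sigma> j)))"
    by (simp add: det_def partial_def sum_distrib_left)
  also have "\<dots> = (\<Sum>i\<in>UNIV. \<Sum>\<sigma>\<in>?P. of_int (sign \<sigma>) *
      (?D $ i $ \<sigma> i * (\<Prod>j\<in>UNIV - {i}. G x $ j $ \<sigma> j)))"
    by (rule sum.swap)
  also have "\<dots> = (\<Sum>i\<in>UNIV. det (\<chi> k. if k = i then ?D $ i else G x $ k))"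
  proof (intro sum.cong refl)
    fix i
    have "(\<Prod>k\<in>UNIV. (if k = i then ?D $ i else G x $ k) $ \<sigma> k) =
       ?D $ i $ \<sigma> i * (\<Prod>j\<in>UNIV - {i}. G x $ j $ \<sigma> j)" for \<sigma>
      by (subst prod.remove[of _ i]) (auto intro!: arg_cong2[where f=times] prod.cong)
    then show "(\<Sum>\<sigma>\<in>?P. of_int (sign \<sigma>) * (?D $ i $ \<sigma> i * (\<Prod>j\<in>UNIV - {i}. G x $ j $ \<sigma> j)))
       = det (\<chi> k. if k = i then ?D $ i else G x $ k)"
      unfolding det_def by simp
  qed
  also have "\<dots> = (\<Sum>i\<in>UNIV. (?D ** K) $ i $ i * det (G x))"
  proof (intro sum.cong refl)
    fix i
    \<comment> \<open>The differentiated row becomes a combination of the rows of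
      \<open>G x\<close>; all but the \<open>i\<close>-th of them produce a repeated row.\<close>
    have "?D = (?D ** K) ** G x" by (simp add: K matrix_mul_assoc[symmetric])
    then have "?D $ i $ j = ((?D ** K) ** G x) $ i $ j" for j by metis
    then have D: "?D $ i = (\<Sum>l\<in>UNIV. (?D ** K) $ i $ l *s G x $ l)"
      by (simp add: vec_eq_iff matrix_matrix_mult_def[of "?D ** K"])
    have "det (\<chi> k. if k = i then ?D $ i else G x $ k) =
        (\<Sum>l\<in>UNIV. det (\<chi> k. if k = i then (?D ** K) $ i $ l *s G x $ l else G x $ k))"
      unfolding D using det_linear_row_sum[of UNIV i "\<lambda>_ l. (?D ** K) $ i $ l *s G x $ l"
          "\<lambda>k. G x $ k"] by simp
    also have "\<dots> = (\<Sum>l\<in>UNIV. (?D ** K) $ i $ l * det (\<chi> k. if k = i then G x $ l else G x $ k))"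
      by (intro sum.cong refl) (rule det_row_mul)
    also have "\<dots> = (\<Sum>l\<in>UNIV. if l = i then (?D ** K) $ i $ i * det (G x) else 0)"
    proof (intro sum.cong refl)
      fix l
      show "(?D ** K) $ i $ l * det (\<chi> k. if k = i then G x $ l else G x $ k)
        = (if l = i then (?D ** K) $ i $ i * det (G x) else 0)"
      proof (cases "l = i")
        case True
        then have "(\<chi> k. if k = i then G x $ l else G x $ k) = G x" by (simp add: vec_eq_iff)
        then show ?thesis using True by simp
      next
        case False
        then have "det (\<chi> k. if k = i then G x $ l else G x $ k) = 0"
          by (intro det_identical_rows[of i l]) (auto simp: row_def)
        then show ?thesis using False by simp
      qed
    qed
    finally show "det (\<chi> k. if k = i then ?D $ i else G x $ k) = (?D ** K) $ i $ i * det (G x)"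
      by simp
  qed
  also have "\<dots> = det (G x) * trace (K ** ?D)"
    unfolding trace_mul_sym[of K] by (simp add: trace_def sum_distrib_left mult.commute)
  finally show ?thesis by (simp add: trace_def matrix_matrix_mult_def)
qed

text \<open>The quotient rule in logarithmic form, so that the derivative of \<open>v' / v\<close>
  is this quotient times a difference of logarithmic derivatives.\<close>

lemma partial_divide_log:
  assumes "f differentiable (at x)" "g differentiable (at x)" "f x \<noteq> 0" "g x \<noteq> 0"
  shows "partial i (\<lambda>y. f y / g y) x = f x / g x * (partial i f x / f x - partial i g x / g x)"
proof -
  have *: "partial i (\<lambda>y. f y / g y) x = - f x * (inverse (g x) * partial i g x * inverse (g x))
      + partial i f x / g x"
    using partial_eqI[OF has_derivative_divide[OF assms(1,2)[THEN has_derivative_frechet] assms(4)]]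
    by (simp add: partial_def)
  show ?thesis unfolding * using assms(3,4) by (simp add: field_simps)
qed

text \<open>Since \<open>s\<close> is \<open>\<mu>\<close> times \<open>g'\<close>, its derivative
  is \<open>\<mu>\<close> times that of \<open>g'\<close> plus a multiple of \<open>g'\<close> by
  the logarithmic derivative \<open>\<rho>\<close>. The trace term of \<open>delta_Gamma\<close>
  removes \<open>\<rho>\<close>, and the Koszul combination of what remains is the difference of the
  connections.\<close>

lemma delta_Gamma_eq:
  fixes g g' :: "real^7 \<Rightarrow> real^7^7" and v v' :: "real^7 \<Rightarrow> real"
  assumes U: "open U" "x \<in> U"
    and g: "\<And>i j. (\<lambda>y. g y $ i $ j) differentiable (at x)" "v differentiable (at x)"
    and g': "\<And>i j. (\<lambda>y. g' y $ i $ j) differentiable (at x)" "v' differentiable (at x)"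
    and sym: "\<And>y. y \<in> U \<Longrightarrow> transpose (g y) = g y" "\<And>y. y \<in> U \<Longrightarrow> transpose (g' y) = g' y"
    and vol: "\<And>y. y \<in> U \<Longrightarrow> (v y)\<^sup>2 = det (g y)" "\<And>y. y \<in> U \<Longrightarrow> (v' y)\<^sup>2 = det (g' y)"
    and pos: "v x * v' x > 0"
    and s: "\<And>y b c. y \<in> U \<Longrightarrow> s y b c = v' y / v y * g' y $ b $ c"
  shows "delta_Gamma g g' s x a b c = christoffel g' x b a c - christoffel g x b a c"
proof -
  have nz: "v x \<noteq> 0" "v' x \<noteq> 0" using pos by auto
  have det: "det (g x) \<noteq> 0" "det (g' x) \<noteq> 0"
    using vol U(2) nz by (metis zero_eq_power2)+
  obtain K where K: "g x ** K = mat 1" "K ** g x = mat 1"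
      using det(1) by (metis invertible_det_nz invertible_def)
  obtain K' where K': "g' x ** K' = mat 1" "K' ** g' x = mat 1"
      using det(2) by (metis invertible_det_nz invertible_def)
  have inv: "matrix_inv (g x) = K" "matrix_inv (g' x) = K'"
    using K K' by (simp_all add: matrix_inv_eqI)
  define \<Gamma> where "\<Gamma> = christoffel g x"
  define \<mu> where "\<mu> = v' x / v x"
  define D where "D a b c = partial a (\<lambda>y. g y $ b $ c) x" for a b c
  define D' where "D' a b c = partial a (\<lambda>y. g' y $ b $ c) x" for a b c
  define \<rho> where "\<rho> a = partial a v' x / v' x - partial a v x / v x" for a
  \<comment> \<open>\<open>N\<close> is the covariant derivative of \<open>g'\<close> for the
    Levi-Civita connection of \<open>g\<close>.\<close>
  define N where "N a b c = D' a b c - (\<Sum>e\<in>UNIV. \<Gamma> e a b * g' x $ e $ c)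
      - (\<Sum>e\<in>UNIV. \<Gamma> e a c * g' x $ b $ e)" for a b c
  have \<mu>: "\<mu> > 0" using pos by (auto simp add: \<mu>_def zero_less_divide_iff zero_less_mult_iff)
  have gs: "g y $ b $ c = g y $ c $ b" "g' y $ b $ c = g' y $ c $ b" if "y \<in> U" for y b c
    using arg_cong[OF sym(1)[OF that], of "\<lambda>M. M $ c $ b"] arg_cong[OF sym(2)[OF that], of "\<lambda>M. M
        $ c $ b"]
    by (simp_all add: transpose_def)
  have Ds: "D a b c = D a c b" "D' a b c = D' a c b" for a b c
    unfolding D_def D'_def by (rule partial_cong[OF U], rule gs, assumption)+
  have Ks: "K $ m $ n = K $ n $ m" for m n
  proof -
    have "transpose K ** g x = mat 1"
      using K(1) sym(1)[OF U(2)] by (metis matrix_transpose_mul transpose_mat)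
    then have "transpose K = K" using K(1) by (metis matrix_mul_assoc matrix_mul_lid matrix_mul_rid)
    from arg_cong[OF this, of "\<lambda>M. M $ m $ n"] show ?thesis by (simp add: transpose_def)
  qed
  have K'g': "(\<Sum>d\<in>UNIV. K' $ b $ d * g' x $ d $ a) = of_bool (b = a)" for a b
    using arg_cong[OF K'(2), of "\<lambda>M. M $ b $ a"] by (simp add: matrix_matrix_mult_def mat_def)
  have \<Gamma>_sym: "\<Gamma> e a b = \<Gamma> e b a" for e a b
    unfolding \<Gamma>_def christoffel_def by (simp add: Ds(1)[of _ a b, unfolded D_def] add.commute)
  \<comment> \<open>The other two derivatives in the Christoffel symbol cancel in the trace by
    symmetry of \<open>K\<close>.\<close>
  have \<Gamma>_trace: "2 * (\<Sum>m\<in>UNIV. \<Gamma> m a m) = (\<Sum>m\<in>UNIV. \<Sum>n\<in>UNIV. K $ m $ n * D a n m)" for a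
  proof -
    have "2 * (\<Sum>m\<in>UNIV. \<Gamma> m a m) = (\<Sum>m\<in>UNIV. \<Sum>n\<in>UNIV. K $ m $ n * D a n m)
       + ((\<Sum>m\<in>UNIV. \<Sum>n\<in>UNIV. K $ m $ n * D m n a) - (\<Sum>m\<in>UNIV. \<Sum>n\<in>UNIV. K $ m $ n * D n a m))"
      unfolding \<Gamma>_def christoffel_def inv D_def[symmetric]
      by (simp add: sum_distrib_left algebra_simps sum.distrib sum_subtractf)
    moreover have "(\<Sum>m\<in>UNIV. \<Sum>n\<in>UNIV. K $ m $ n * D n a m)
        = (\<Sum>m\<in>UNIV. \<Sum>n\<in>UNIV. K $ m $ n * D m n a)"
      by (subst sum.swap) (simp add: Ks[of _ _] Ds(1)[of _ a] cong: sum.cong)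
    ultimately show ?thesis by simp
  qed
  \<comment> \<open>Differentiates the square of \<open>w\<close> as a determinant; the 2 comes from
    the square. The sign of \<open>w\<close> does not enter.\<close>
  have logdet: "2 * (partial a w x / w x) = (\<Sum>m\<in>UNIV. \<Sum>n\<in>UNIV. L $ m $ n
      * partial a (\<lambda>y. h y $ n $ m) x)"
    if "\<And>i j. (\<lambda>y. h y $ i $ j) differentiable (at x)" "w differentiable (at x)" "L ** h x = mat 1"
      "\<And>y. y \<in> U \<Longrightarrow> (w y)\<^sup>2 = det (h y)" "w x \<noteq> 0" for h :: "real^7 \<Rightarrow> real^7^7" and w L a
  proof -
    have "partial a (\<lambda>y. w y * w y) x = partial a (\<lambda>y. det (h y)) x"
      by (rule partial_cong[OF U]) (use that(4) in \<open>simp add: power2_eq_square\<close>)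
    then have "2 * (w x * partial a w x) = (w x)\<^sup>2 * (\<Sum>m\<in>UNIV. \<Sum>n\<in>UNIV. L $ m $ n
        * partial a (\<lambda>y. h y $ n $ m) x)"
      by (simp add: partial_mult[OF that(2,2)] partial_det[OF that(1,3)] that(4)[OF U(2)]
          mult.commute)
    then show ?thesis using that(5) by (simp add: power2_eq_square field_simps)
  qed
  have g'K': "(\<Sum>m\<in>UNIV. K' $ m $ n * g' x $ m $ e) = of_bool (e = n)" for n e
    using arg_cong[OF K'(1), of "\<lambda>M. M $ e $ n"] gs(2)[OF U(2), of _ e]
    by (simp add: matrix_matrix_mult_def mat_def mult.commute)
  have K'g'2: "(\<Sum>d\<in>UNIV. K' $ b $ d * g' x $ a $ d) = of_bool (b = a)" for a b
    using K'g'[of b a] gs(2)[OF U(2), of a] by simp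
  have trg': "(\<Sum>m\<in>UNIV. \<Sum>n\<in>UNIV. K' $ m $ n * g' x $ m $ n) = 7"
    by (simp add: K'g'2)
  \<comment> \<open>The trace of \<open>D'\<close> is twice the logarithmic derivative of
    \<open>v'\<close>; each of the two connection terms subtracts the trace of
    \<open>\<Gamma>\<close>, which is the logarithmic derivative of \<open>v\<close>.\<close>
  have trN: "(\<Sum>m\<in>UNIV. \<Sum>n\<in>UNIV. K' $ m $ n * N a m n) = 2 * \<rho> a" for a
  proof -
    have "(\<Sum>m\<in>UNIV. \<Sum>n\<in>UNIV. K' $ m $ n * (\<Sum>e\<in>UNIV. \<Gamma> e a n * g' x $ m $ e)) = (\<Sum>m\<in>UNIV. \<Gamma> m a m)"
      unfolding sum_contract_swap g'K' by (simp
          add: of_bool_def if_distrib[where f="\<lambda>t. _ * t"] cong: if_cong)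
    moreover have "(\<Sum>m\<in>UNIV. \<Sum>n\<in>UNIV. K' $ m $ n * (\<Sum>e\<in>UNIV. \<Gamma> e a m * g' x $ e $ n))
        = (\<Sum>m\<in>UNIV. \<Gamma> m a m)"
      by (subst sum.swap) (unfold sum_contract_swap[where k="\<lambda>n m. K' $ m $ n" and h="\<lambda>n e. g' x $
          e $ n"] K'g'2,
        simp add: of_bool_def if_distrib[where f="\<lambda>t. _ * t"] cong: if_cong)
    moreover have "(\<Sum>m\<in>UNIV. \<Sum>n\<in>UNIV. K' $ m $ n * D' a m n) = 2 * (partial a v' x / v' x)"
      using logdet[OF g' K'(2) vol(2) nz(2), of a] by (simp add: D'_def[symmetric] Ds(2)[of a])
    moreover have "(\<Sum>m\<in>UNIV. \<Sum>n\<in>UNIV. K $ m $ n * D a n m) = 2 * (partial a v x / v x)"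
      using logdet[OF g K(2) vol(1) nz(1), of a] by (simp add: D_def[symmetric])
    moreover have "(\<Sum>m\<in>UNIV. \<Sum>n\<in>UNIV. K' $ m $ n * N a m n)
        = (\<Sum>m\<in>UNIV. \<Sum>n\<in>UNIV. K' $ m $ n * D' a m n)
       - (\<Sum>m\<in>UNIV. \<Sum>n\<in>UNIV. K' $ m $ n * (\<Sum>e\<in>UNIV. \<Gamma> e a m * g' x $ e $ n))
       - (\<Sum>m\<in>UNIV. \<Sum>n\<in>UNIV. K' $ m $ n * (\<Sum>e\<in>UNIV. \<Gamma> e a n * g' x $ m $ e))"
      unfolding N_def by (simp only: right_diff_distrib sum_subtractf)
    ultimately show ?thesis
      using \<Gamma>_trace[of a] by (simp add: \<rho>_def)
  qed
  have nab: "nabla2 g s x a b c = \<mu> * (N a b c + \<rho> a * g' x $ b $ c)" for a b c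
  proof -
    have "partial a (\<lambda>y. s y b c) x = partial a (\<lambda>y. v' y / v y * g' y $ b $ c) x"
      by (rule partial_cong[OF U]) (rule s)
    also have "\<dots> = \<mu> * D' a b c + \<mu> * \<rho> a * g' x $ b $ c"
    proof -
      have "(\<lambda>y. v' y / v y) differentiable (at x)"
        using g'(2) g(2) nz(1) by (rule differentiable_divide)
      from partial_mult[OF this g'(1)] show ?thesis
        by (simp add: partial_divide_log[OF g'(2) g(2) nz(2,1)] \<mu>_def D'_def \<rho>_def)
    qed
    finally show ?thesis
      unfolding nabla2_def N_def s[OF U(2)] \<mu>_def[symmetric] \<Gamma>_def[symmetric]
      by (simp add: sum_distrib_left algebra_simps)
  qed
  \<comment> \<open>\<open>9 = 2 + 7\<close>: \<open>trN\<close> gives 2, by Jacobi's formula, and the trace of \<open>g'\<close> is 7.\<close>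
  have tr: "(\<Sum>m\<in>UNIV. \<Sum>n\<in>UNIV. K' $ m $ n * nabla2 g s x e m n) = 9 * \<mu> * \<rho> e" for e
  proof -
    have "(\<Sum>m\<in>UNIV. \<Sum>n\<in>UNIV. K' $ m $ n * nabla2 g s x e m n) =
      \<mu> * ((\<Sum>m\<in>UNIV. \<Sum>n\<in>UNIV. K' $ m $ n * N e m n)
          + \<rho> e * (\<Sum>m\<in>UNIV. \<Sum>n\<in>UNIV. K' $ m $ n * g' x $ m $ n))"
      unfolding nab by (simp add: sum_distrib_left sum.distrib algebra_simps)
    then show ?thesis unfolding trN trg' by simp
  qed
  \<comment> \<open>The Koszul combination: by symmetry of \<open>\<Gamma>\<close> four of the six
    connection terms cancel and two coincide.\<close>
  have N: "N c a d + N a c d - N d a c = D' a d c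
      + D' c d a - D' d a c - 2 * (\<Sum>e\<in>UNIV. \<Gamma> e a c * g' x $ d $ e)" for d
    unfolding N_def \<Gamma>_sym[of _ c a] \<Gamma>_sym[of _ d a] \<Gamma>_sym[of _ d c]
      gs(2)[OF U(2), of _ d] gs(2)[OF U(2), of _ c] Ds(2)[of _ a d] Ds(2)[of _ c d]
    by (simp add: Ds(2)[of _ a d] Ds(2)[of _ c d])
  \<comment> \<open>The one-element type \<open>1\<close> serves as a dummy index, so that the
    double-sum lemma covers a single sum.\<close>
  have "(\<Sum>d\<in>UNIV. K' $ b $ d * (\<Sum>e\<in>UNIV. \<Gamma> e a c * g' x $ d $ e)) = \<Gamma> b a c"
    using sum_contract_swap[where k="\<lambda>d (_::1). K' $ b $ d" and t="\<lambda>e _. \<Gamma> e a c" and h="\<lambda>d e. g'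
        x $ d $ e"]
    by (simp add: K'g' of_bool_def if_distrib[where f="\<lambda>t. _ * t"] cong: if_cong)
  then have KN: "(\<Sum>d\<in>UNIV. K' $ b $ d * (N c a d + N a c d - N d a c))
      = 2 * (christoffel g' x b a c - \<Gamma> b a c)"
    unfolding N christoffel_def inv D'_def[symmetric]
    by (simp add: right_diff_distrib sum_subtractf sum_distrib_left[symmetric]
        mult.left_commute[of _ 2])
  \<comment> \<open>Agreement of orientations makes \<open>\<mu>\<close> positive, which selects the
    right square root.\<close>
  have "sqrt (det (g x) / det (g' x)) = 1 / \<mu>"
  proof -
    have "det (g x) / det (g' x) = (1 / \<mu>)\<^sup>2"
      unfolding vol[OF U(2), symmetric] by (simp add: \<mu>_def power_divide)
    then show ?thesis using \<mu> by simp
  qed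
  moreover have eqs: "(b = a) = (a = b)" "(b = c) = (c = b)" by auto
  ultimately have "delta_Gamma g g' s x a b c = 1 / 2 * (1 / \<mu>) *
    ((\<Sum>d\<in>UNIV. K' $ b $ d * (\<mu> * ((N c a d + N a c d - N d a c) + \<rho> c * g' x $ a $ d
        + \<rho> a * g' x $ c $ d - \<rho> d * g' x $ a $ c)))
     - 1 / 9 * (\<Sum>e\<in>UNIV. (of_bool (a = b) * of_bool (c = e) + of_bool (c = b) * of_bool (a = e)
        - g' x $ a $ c * K' $ b $ e) * (9 * \<mu> * \<rho> e)))"
    unfolding delta_Gamma_def inv tr unfolding nab by (simp add: algebra_simps)
  also have "(\<Sum>d\<in>UNIV. K' $ b $ d * (\<mu> * ((N c a d + N a c d - N d a c) + \<rho> c * g' x $ a $ d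
      + \<rho> a * g' x $ c $ d - \<rho> d * g' x $ a $ c)))
     = \<mu> * ((\<Sum>d\<in>UNIV. K' $ b $ d * (N c a d + N a c d - N d a c))
       + \<rho> c * (\<Sum>d\<in>UNIV. K' $ b $ d * g' x $ a $ d) + \<rho> a * (\<Sum>d\<in>UNIV. K' $ b $ d * g' x $ c $ d)
       - g' x $ a $ c * (\<Sum>d\<in>UNIV. K' $ b $ d * \<rho> d))"
    by (simp only: sum_distrib_left sum.distrib[symmetric] sum_subtractf[symmetric])
      (simp add: algebra_simps)
  also have "(\<Sum>e\<in>UNIV. (of_bool (a = b) * of_bool (c = e) + of_bool (c = b) * of_bool (a = e)
        - g' x $ a $ c * K' $ b $ e) * (9 * \<mu> * \<rho> e))
     = 9 * \<mu> * (of_bool (a = b) * \<rho> c + of_bool (c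
         = b) * \<rho> a - g' x $ a $ c * (\<Sum>e\<in>UNIV. K' $ b $ e * \<rho> e))"
  proof -
    have "(\<Sum>e\<in>UNIV. (of_bool (a = b) * of_bool (c = e) + of_bool (c = b) * of_bool (a = e)
        - g' x $ a $ c * K' $ b $ e) * (9 * \<mu> * \<rho> e))
     = 9 * \<mu> * (of_bool (a = b) * (\<Sum>e\<in>UNIV. of_bool (c = e) * \<rho> e) + of_bool (c
         = b) * (\<Sum>e\<in>UNIV. of_bool (a = e) * \<rho> e)
        - g' x $ a $ c * (\<Sum>e\<in>UNIV. K' $ b $ e * \<rho> e))"
      by (simp only: sum_distrib_left sum.distrib[symmetric] sum_subtractf[symmetric])
        (simp add: algebra_simps)
    moreover have "(\<Sum>e\<in>UNIV. of_bool (c = e) * \<rho> e) = \<rho> c" for c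
      by (simp add: of_bool_def if_distrib[where f="\<lambda>t. t * _"] cong: if_cong)
    ultimately show ?thesis by (simp only:)
  qed
  \<comment> \<open>The contraction and the trace correction contain the same \<open>\<rho>\<close>
    terms, so they drop out of \<open>X - Y\<close>.\<close>
  also have "1 / 2 * (1 / \<mu>) * (\<mu> * X - 1 / 9 * (9 * \<mu> * Y)) = (X - Y) / 2" for X Y
    using \<mu> by (simp add: field_simps)
  finally show ?thesis
    unfolding KN K'g'2 \<Gamma>_def eqs by simp
qed

subsection \<open>The deformed torsion\<close>

lemma smooth_on_differentiable:
  assumes "smooth_on U f" "open U" "x \<in> U"
  shows "f differentiable (at x)"
proof -
  have "Ck_on (Suc 0) U f" using assms(1) unfolding smooth_on_def by blast
  then show ?thesis using assms(2,3) by (simp add: differentiable_on_eq_differentiable_at)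
qed

lemma nabla3_add:
  assumes "\<And>b c d. (\<lambda>y. \<alpha> y b c d) differentiable (at x)"
      "\<And>b c d. (\<lambda>y. \<beta> y b c d) differentiable (at x)"
  shows "nabla3 G (\<lambda>y b c d. \<alpha> y b c d + \<beta> y b c d) x a b c d
      = nabla3 G \<alpha> x a b c d + nabla3 G \<beta> x a b c d"
  unfolding nabla3_def partial_add[OF assms] by (simp add: distrib_left sum.distrib)

lemma nabla3_change:
  assumes "\<And>e b. \<delta> a e b = christoffel G' x e a b - christoffel G x e a b"
  shows "nabla3 G' \<omega> x a b c d = nabla3 G \<omega> x a b c d - (\<Sum>e\<in>UNIV. \<delta> a e b * \<omega> x e c d)
    - (\<Sum>e\<in>UNIV. \<delta> a e c * \<omega> x b e d) - (\<Sum>e\<in>UNIV. \<delta> a e d * \<omega> x b c e)"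
  unfolding nabla3_def assms by (simp add: left_diff_distrib sum_subtractf)

text \<open>The three correction terms, one per slot of the form, agree after contraction with the
  alternating dual. Each gives \<open>4 * v\<close> by \<open>g2_at_contract_dual\<close>, hence
  12.\<close>

lemma nabla3_change_contract:
  assumes \<phi>: "g2_at (\<omega> x) H v"
    and \<delta>: "\<And>e b. \<delta> a e b = christoffel G' x e a b - christoffel G x e a b"
  shows "(\<Sum>b\<in>UNIV. \<Sum>c\<in>UNIV. \<Sum>d\<in>UNIV. nabla3 G' \<omega> x a b c d * dual3 (\<omega> x) m b c d)
    = (\<Sum>b\<in>UNIV. \<Sum>c\<in>UNIV. \<Sum>d\<in>UNIV. nabla3 G \<omega> x a b c d * dual3 (\<omega> x) m b c d)
      - 12 * v * (\<Sum>e\<in>UNIV. \<Sum>b\<in>UNIV. \<delta> a e b * raise23 H (\<omega> x) e m b)"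
proof -
  let ?D = "dual3 (\<omega> x) m"
  let ?S = "\<Sum>b\<in>UNIV. \<Sum>c\<in>UNIV. \<Sum>d\<in>UNIV. (\<Sum>e\<in>UNIV. \<delta> a e b * \<omega> x e c d) * ?D b c d"
  have \<omega>: "\<omega> x j i k = - \<omega> x i j k" "\<omega> x i k j = - \<omega> x i j k" for i j k
    using \<phi> unfolding g2_at_def alternating3_def by (metis add.inverse_inverse)+
  have "?S = (\<Sum>b\<in>UNIV. \<Sum>e\<in>UNIV. \<delta> a e b * (\<Sum>c\<in>UNIV. \<Sum>d\<in>UNIV. \<omega> x e c d * ?D b c d))"
    using sum_linear2[where r="\<lambda>e. \<delta> a e b" and Y="\<lambda>e c d. \<omega> x e c d" and X="?D b" for b]
    by (simp add: mult.commute)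
  also have "\<dots> = 4 * v * (\<Sum>e\<in>UNIV. \<Sum>b\<in>UNIV. \<delta> a e b * raise23 H (\<omega> x) e m b)"
    unfolding g2_at_contract_dual[OF \<phi>] by (subst sum.swap) (simp add: sum_distrib_left mult_ac)
  finally have S: "?S = 4 * v * (\<Sum>e\<in>UNIV. \<Sum>b\<in>UNIV. \<delta> a e b * raise23 H (\<omega> x) e m b)" .
  have S2: "(\<Sum>b\<in>UNIV. \<Sum>c\<in>UNIV. \<Sum>d\<in>UNIV. (\<Sum>e\<in>UNIV. \<delta> a e c * \<omega> x b e d) * ?D b c d) = ?S"
  proof -
    \<comment> \<open>Exchanging two slots in both the form and the dual changes two signs; renaming
      the summed indices then reduces to the first slot.\<close>
    have "(\<Sum>e\<in>UNIV. \<delta> a e c * \<omega> x b e d) * ?D b c d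
        = (\<Sum>e\<in>UNIV. \<delta> a e c * \<omega> x e b d) * ?D c b d" for b c d
      unfolding dual3_swap(1)[of _ m b c d] \<omega>(1)[of b] by (simp add: sum_negf)
    then show ?thesis by (simp only:) (rule sum.swap)
  qed
  have S3: "(\<Sum>b\<in>UNIV. \<Sum>c\<in>UNIV. \<Sum>d\<in>UNIV. (\<Sum>e\<in>UNIV. \<delta> a e d * \<omega> x b c e) * ?D b c d) = ?S"
  proof -
    have "(\<Sum>e\<in>UNIV. \<delta> a e d * \<omega> x b c e) * ?D b c d
        = (\<Sum>e\<in>UNIV. \<delta> a e d * \<omega> x b e c) * ?D b d c" for b c d
      unfolding dual3_swap(2)[of _ m b c d] \<omega>(2)[of b c] by (simp add: sum_negf)
    then have "(\<Sum>b\<in>UNIV. \<Sum>c\<in>UNIV. \<Sum>d\<in>UNIV. (\<Sum>e\<in>UNIV. \<delta> a e d * \<omega> x b c e) * ?D b c d)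
      = (\<Sum>b\<in>UNIV. \<Sum>c\<in>UNIV. \<Sum>d\<in>UNIV. (\<Sum>e\<in>UNIV. \<delta> a e c * \<omega> x b e d) * ?D b c d)"
      by (simp only:) (rule sum.cong[OF refl], rule sum.swap)
    then show ?thesis using S2 by simp
  qed
  have "(\<Sum>b\<in>UNIV. \<Sum>c\<in>UNIV. \<Sum>d\<in>UNIV. nabla3 G' \<omega> x a b c d * ?D b c d)
    = (\<Sum>b\<in>UNIV. \<Sum>c\<in>UNIV. \<Sum>d\<in>UNIV. nabla3 G \<omega> x a b c d * ?D b c d) - ?S
      - (\<Sum>b\<in>UNIV. \<Sum>c\<in>UNIV. \<Sum>d\<in>UNIV. (\<Sum>e\<in>UNIV. \<delta> a e c * \<omega> x b e d) * ?D b c d)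
      - (\<Sum>b\<in>UNIV. \<Sum>c\<in>UNIV. \<Sum>d\<in>UNIV. (\<Sum>e\<in>UNIV. \<delta> a e d * \<omega> x b c e) * ?D b c d)"
    unfolding nabla3_change[of \<delta>, OF \<delta>] by (simp only: left_diff_distrib sum_subtractf)
  then show ?thesis unfolding S2 S3 S by simp
qed

text \<open>Recovers the torsion from the covariant derivative of the form by contraction with the
  dual.\<close>

lemma contract_torsion:
  assumes "g2_at \<phi> G v"
  shows "(\<Sum>b\<in>UNIV. \<Sum>c\<in>UNIV. \<Sum>d\<in>UNIV. (\<Sum>e\<in>UNIV. t e * hodge3 G v \<phi> e b c d) * dual3 \<phi> m b c d)
      = 24 * v * t m"
  unfolding sum_linear3 g2_at_contract_hodge_dual[OF assms]
  by (simp add: of_bool_def if_distrib[where f="\<lambda>t. _ * t"] cong: if_cong)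

theorem lemma15:
  fixes X :: "'a topology" and A :: "'a chart set"
    and \<phi> \<phi>' chi :: "'a chart \<Rightarrow> real^7 \<Rightarrow> cov3"
    and g g' :: "'a chart \<Rightarrow> real^7 \<Rightarrow> real^7^7"
    and v v' :: "'a chart \<Rightarrow> real^7 \<Rightarrow> real"
    and T T' :: "'a chart \<Rightarrow> real^7 \<Rightarrow> cov2"
  assumes "smooth_manifold7 X A"
    and "g2_structure A \<phi> g v"
    and "full_torsion A \<phi> g v T"
    and "three_form A chi"
    and "\<And>\<kappa> x i j k. \<phi>' \<kappa> x i j k = \<phi> \<kappa> x i j k + chi \<kappa> x i j k"
    and "g2_structure A \<phi>' g' v'"
    and "same_orientation A v v'"
    and "full_torsion A \<phi>' g' v' T'"
  shows "\<forall>\<kappa>\<in>A. \<forall>x\<in>coords \<kappa>. \<forall>a m.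
    (let psi = hodge3 (g \<kappa> x) (v \<kappa> x) (\<phi> \<kappa> x);
         psi_up = raise1234 (g \<kappa> x) psi;
         star_chi_up = raise1234 (g \<kappa> x) (hodge3 (g \<kappa> x) (v \<kappa> x) (chi \<kappa> x));
         nabla_chi = nabla3 (g \<kappa>) (chi \<kappa>) x;
         s = (\<lambda>y. s_tensor (g \<kappa> y) (v \<kappa> y) (\<phi> \<kappa> y) (chi \<kappa> y));
         \<delta>\<Gamma> = delta_Gamma (g \<kappa>) (g' \<kappa>) s x
     in raise2 (g' \<kappa> x) (T' \<kappa> x) a m =
          sqrt (det (g \<kappa> x) / det (g' \<kappa> x)) *
            (raise2 (g \<kappa> x) (T \<kappa> x) a m
             + 1 / 24 * (\<Sum>e\<in>UNIV. \<Sum>b\<in>UNIV. \<Sum>c\<in>UNIV. \<Sum>d\<in>UNIV.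
                 raise2 (g \<kappa> x) (T \<kappa> x) a e * psi e b c d * star_chi_up m b c d)
             + 1 / 24 * (\<Sum>b\<in>UNIV. \<Sum>c\<in>UNIV. \<Sum>d\<in>UNIV. psi_up m b c d * nabla_chi a b c d)
             + 1 / 24 * (\<Sum>b\<in>UNIV. \<Sum>c\<in>UNIV. \<Sum>d\<in>UNIV. nabla_chi a b c d * star_chi_up m b c d))
          - 1 / 2 * (\<Sum>e\<in>UNIV. \<Sum>b\<in>UNIV. \<delta>\<Gamma> a e b * raise23 (g' \<kappa> x) (\<phi>' \<kappa> x) e m b))"
proof (intro ballI allI)
  fix \<kappa> x a m
  assume \<kappa>: "\<kappa> \<in> A" and x: "x \<in> coords \<kappa>"
  note g2 = assms(2)[unfolded g2_structure_def] assms(6)[unfolded g2_structure_def]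
  have U: "open (coords \<kappa>)" using assms(1) \<kappa> unfolding smooth_manifold7_def by blast
  have vv: "v \<kappa> y * v' \<kappa> y > 0" if "y \<in> coords \<kappa>" for y
    using assms(7) \<kappa> that unfolding same_orientation_def by blast
  have at: "g2_at (\<phi> \<kappa> y) (g \<kappa> y) (v \<kappa> y)" "g2_at (\<phi>' \<kappa> y) (g' \<kappa> y) (v' \<kappa> y)" if "y \<in> coords \<kappa>"
      for y
  proof -
    have "v \<kappa> y \<noteq> 0" "v' \<kappa> y \<noteq> 0" using vv[OF that] by auto
    then show "g2_at (\<phi> \<kappa> y) (g \<kappa> y) (v \<kappa> y)" "g2_at (\<phi>' \<kappa> y) (g' \<kappa> y) (v' \<kappa> y)"
      using g2 \<kappa> that unfolding g2_at_def three_form_def riemannian_metric_def volume_form_def by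
          simp_all
  qed
  have chi: "alternating3 (chi \<kappa> y)" if "y \<in> coords \<kappa>" for y
    using assms(4) \<kappa> that unfolding three_form_def by blast
  have \<phi>': "\<phi>' \<kappa> y = (\<lambda>i j k. \<phi> \<kappa> y i j k + chi \<kappa> y i j k)" for y
    using assms(5) by (intro ext)
  have s: "s_tensor (g \<kappa> y) (v \<kappa> y) (\<phi> \<kappa> y) (chi \<kappa> y) b c = v' \<kappa> y / v \<kappa> y * g' \<kappa> y $ b $ c"
    if "y \<in> coords \<kappa>" for y b c
    using s_tensor_eq[OF at[OF that] chi[OF that] \<phi>'] .
  have smooth: "smooth_on (coords \<kappa>) (\<lambda>y. g \<kappa> y $ i $ j)"
      "smooth_on (coords \<kappa>) (\<lambda>y. g' \<kappa> y $ i $ j)"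
    "smooth_on (coords \<kappa>) (v \<kappa>)" "smooth_on (coords \<kappa>) (v' \<kappa>)"
    "smooth_on (coords \<kappa>) (\<lambda>y. \<phi> \<kappa> y i j k)" "smooth_on (coords \<kappa>) (\<lambda>y. chi \<kappa> y i j k)" for i j k
    using g2 assms(4) \<kappa> unfolding three_form_def riemannian_metric_def volume_form_def by simp_all
  note diff = smooth[THEN smooth_on_differentiable, OF U x]
  define \<delta> where "\<delta> = delta_Gamma (g \<kappa>) (g' \<kappa>) (\<lambda>y. s_tensor (g \<kappa> y) (v \<kappa> y) (\<phi> \<kappa> y) (chi \<kappa> y)) x"
  have \<delta>: "\<delta> a e b = christoffel (g' \<kappa>) x e a b - christoffel (g \<kappa>) x e a b" for e b
    unfolding \<delta>_def
    by (rule delta_Gamma_eq[OF U x diff(1,3,2,4) _ _ _ _ vv[OF x] s])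
      (use at in \<open>auto simp: g2_at_def\<close>)
  define t where "t = raise2 (g \<kappa> x) (T \<kappa> x) a"
  define t' where "t' = raise2 (g' \<kappa> x) (T' \<kappa> x) a"
  define \<psi> where "\<psi> = hodge3 (g \<kappa> x) (v \<kappa> x) (\<phi> \<kappa> x)"
  define D where "D = dual3 (\<phi> \<kappa> x) m"
  define E where "E = dual3 (chi \<kappa> x) m"
  define N where "N = nabla3 (g \<kappa>) (chi \<kappa>) x a"
  define R where "R = (\<Sum>e\<in>UNIV. \<Sum>b\<in>UNIV. \<delta> a e b * raise23 (g' \<kappa> x) (\<phi>' \<kappa> x) e m b)"
  have T: "nabla3 (g \<kappa>) (\<phi> \<kappa>) x a b c d = (\<Sum>e\<in>UNIV. t e * \<psi> e b c d)" for b c d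
    using assms(3) \<kappa> x unfolding full_torsion_def t_def \<psi>_def by simp
  have T': "nabla3 (g' \<kappa>) (\<phi>' \<kappa>) x a b c d
      = (\<Sum>e\<in>UNIV. t' e * hodge3 (g' \<kappa> x) (v' \<kappa> x) (\<phi>' \<kappa> x) e b c d)" for b c d
    using assms(8) \<kappa> x unfolding full_torsion_def t'_def by simp
  have \<phi>'_fun: "\<phi>' \<kappa> = (\<lambda>y i j k. \<phi> \<kappa> y i j k + chi \<kappa> y i j k)"
    using \<phi>' by (intro ext) simp
  \<comment> \<open>The dual without a metric is linear in the form, so no change of metric enters
    when \<open>\<phi>'\<close> is split.\<close>
  have DE: "dual3 (\<phi>' \<kappa> x) m b c d = D b c d + E b c d" for b c d
    unfolding \<phi>' D_def E_def dual3_def by (simp add: distrib_right sum.distrib add_divide_distrib)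
  have nab: "nabla3 (g \<kappa>) (\<phi>' \<kappa>) x a b c d = (\<Sum>e\<in>UNIV. t e * \<psi> e b c d) + N b c d" for b c d
    unfolding \<phi>'_fun N_def nabla3_add[OF diff(5,6)] T ..
  have tD: "(\<Sum>b\<in>UNIV. \<Sum>c\<in>UNIV. \<Sum>d\<in>UNIV. (\<Sum>e\<in>UNIV. t e * \<psi> e b c d) * D b c d) = 24 * v \<kappa> x * t m"
    unfolding \<psi>_def D_def by (rule contract_torsion[OF at(1)[OF x]])
  have tE: "(\<Sum>b\<in>UNIV. \<Sum>c\<in>UNIV. \<Sum>d\<in>UNIV. (\<Sum>e\<in>UNIV. t e * \<psi> e b c d) * E b c d)
     = (\<Sum>e\<in>UNIV. \<Sum>b\<in>UNIV. \<Sum>c\<in>UNIV. \<Sum>d\<in>UNIV. t e * \<psi> e b c d * E b c d)"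
    unfolding sum_linear3 by (simp add: sum_distrib_left mult.assoc)
  \<comment> \<open>The defining equation of the new torsion is contracted with the dual of
    \<open>\<phi>'\<close>, then the new connection is exchanged for the old one at the cost of
    \<open>R\<close>.\<close>
  have "24 * v' \<kappa> x * t' m = (\<Sum>b\<in>UNIV. \<Sum>c\<in>UNIV. \<Sum>d\<in>UNIV.
      nabla3 (g' \<kappa>) (\<phi>' \<kappa>) x a b c d * dual3 (\<phi>' \<kappa> x) m b c d)"
    unfolding T' contract_torsion[OF at(2)[OF x]] ..
  also have "\<dots> = (\<Sum>b\<in>UNIV. \<Sum>c\<in>UNIV. \<Sum>d\<in>UNIV.
      nabla3 (g \<kappa>) (\<phi>' \<kappa>) x a b c d * dual3 (\<phi>' \<kappa> x) m b c d) - 12 * v' \<kappa> x * R"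
    unfolding R_def
    by (rule nabla3_change_contract[where \<omega>="\<phi>' \<kappa>" and x=x and \<delta>=\<delta>, OF at(2)[OF x] \<delta>])
  \<comment> \<open>Derivative and dual both split into a \<open>\<phi>\<close> part and a
    \<open>chi\<close> part; the four products are the four terms in the bracket of the
    claim.\<close>
  also have "(\<Sum>b\<in>UNIV. \<Sum>c\<in>UNIV. \<Sum>d\<in>UNIV. nabla3 (g \<kappa>) (\<phi>' \<kappa>) x a b c d * dual3 (\<phi>' \<kappa> x) m b c d)
     = 24 * v \<kappa> x * t m
     + (\<Sum>e\<in>UNIV. \<Sum>b\<in>UNIV. \<Sum>c\<in>UNIV. \<Sum>d\<in>UNIV. t e * \<psi> e b c d * E b c d)
     + (\<Sum>b\<in>UNIV. \<Sum>c\<in>UNIV. \<Sum>d\<in>UNIV. D b c d * N b c d)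
     + (\<Sum>b\<in>UNIV. \<Sum>c\<in>UNIV. \<Sum>d\<in>UNIV. N b c d * E b c d)"
    unfolding tD[symmetric] tE[symmetric] nab DE by (simp
        add: distrib_left distrib_right sum.distrib mult.commute)
  finally have main: "24 * v' \<kappa> x * t' m = 24 * v \<kappa> x * t m
     + (\<Sum>e\<in>UNIV. \<Sum>b\<in>UNIV. \<Sum>c\<in>UNIV. \<Sum>d\<in>UNIV. t e * \<psi> e b c d * E b c d)
     + (\<Sum>b\<in>UNIV. \<Sum>c\<in>UNIV. \<Sum>d\<in>UNIV. D b c d * N b c d)
     + (\<Sum>b\<in>UNIV. \<Sum>c\<in>UNIV. \<Sum>d\<in>UNIV. N b c d * E b c d) - 12 * v' \<kappa> x * R" .
  have nz: "v \<kappa> x \<noteq> 0" "v' \<kappa> x \<noteq> 0" using vv[OF x] by auto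
  have G: "transpose (g \<kappa> x) = g \<kappa> x" "(v \<kappa> x)\<^sup>2 = det (g \<kappa> x)" "det (g \<kappa> x) \<noteq> 0"
    and G': "(v' \<kappa> x)\<^sup>2 = det (g' \<kappa> x)"
    using at[OF x] unfolding g2_at_def by auto
  have up: "raise1234 (g \<kappa> x) \<psi> m b c d = D b c d / v \<kappa> x"
    "raise1234 (g \<kappa> x) (hodge3 (g \<kappa> x) (v \<kappa> x) (chi \<kappa> x)) m b c d = E b c d / v \<kappa> x" for b c d
    unfolding \<psi>_def raise1234_hodge3[OF G] D_def E_def by simp_all
  \<comment> \<open>The square root is this quotient and not its negative because the two volume
    forms have the same sign.\<close>
  have sq: "sqrt (det (g \<kappa> x) / det (g' \<kappa> x)) = v \<kappa> x / v' \<kappa> x"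
  proof -
    have "v \<kappa> x / v' \<kappa> x > 0" using vv[OF x] by (auto simp: zero_less_divide_iff zero_less_mult_iff)
    moreover have "det (g \<kappa> x) / det (g' \<kappa> x) = (v \<kappa> x / v' \<kappa> x)\<^sup>2"
      by (simp add: G(2)[symmetric] G'[symmetric] power_divide)
    ultimately show ?thesis by (metis real_sqrt_unique less_imp_le)
  qed
  \<comment> \<open>Stated for arbitrary reals, so that \<open>field_simps\<close> does not meet the
    sums.\<close>
  have solve: "t1 = w / w' * (t0 + 1 / 24 * (S1 / w) + 1 / 24 * (S2 / w)
      + 1 / 24 * (S3 / w)) - 1 / 2 * r"
    if "24 * w' * t1 = 24 * w * t0 + S1 + S2 + S3 - 12 * w' * r" "w \<noteq> 0" "w' \<noteq> 0"
    for t0 t1 w w' S1 S2 S3 r :: real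
  proof -
    have "t1 = (24 * w' * t1) / (24 * w')" using that(3) by simp
    also have "\<dots> = w / w' * (t0 + 1 / 24 * (S1 / w) + 1 / 24 * (S2 / w)
        + 1 / 24 * (S3 / w)) - 1 / 2 * r"
      unfolding that(1) using that(2,3) by (simp add: field_simps)
    finally show ?thesis .
  qed
  have "t' m = v \<kappa> x / v' \<kappa> x * (t m
      + 1 / 24 * (\<Sum>e\<in>UNIV. \<Sum>b\<in>UNIV. \<Sum>c\<in>UNIV. \<Sum>d\<in>UNIV. t e * \<psi> e b c d * (E b c d / v \<kappa> x))
      + 1 / 24 * (\<Sum>b\<in>UNIV. \<Sum>c\<in>UNIV. \<Sum>d\<in>UNIV. D b c d / v \<kappa> x * N b c d)
      + 1 / 24 * (\<Sum>b\<in>UNIV. \<Sum>c\<in>UNIV. \<Sum>d\<in>UNIV. N b c d * (E b c d / v \<kappa> x))) - 1 / 2 * R"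
    using solve[OF main nz] by (simp add: sum_divide_distrib)
  then show "let psi = hodge3 (g \<kappa> x) (v \<kappa> x) (\<phi> \<kappa> x);
         psi_up = raise1234 (g \<kappa> x) psi;
         star_chi_up = raise1234 (g \<kappa> x) (hodge3 (g \<kappa> x) (v \<kappa> x) (chi \<kappa> x));
         nabla_chi = nabla3 (g \<kappa>) (chi \<kappa>) x;
         s = (\<lambda>y. s_tensor (g \<kappa> y) (v \<kappa> y) (\<phi> \<kappa> y) (chi \<kappa> y));
         \<delta>\<Gamma> = delta_Gamma (g \<kappa>) (g' \<kappa>) s x
     in raise2 (g' \<kappa> x) (T' \<kappa> x) a m =
          sqrt (det (g \<kappa> x) / det (g' \<kappa> x)) *
            (raise2 (g \<kappa> x) (T \<kappa> x) a m
             + 1 / 24 * (\<Sum>e\<in>UNIV. \<Sum>b\<in>UNIV. \<Sum>c\<in>UNIV. \<Sum>d\<in>UNIV.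
                 raise2 (g \<kappa> x) (T \<kappa> x) a e * psi e b c d * star_chi_up m b c d)
             + 1 / 24 * (\<Sum>b\<in>UNIV. \<Sum>c\<in>UNIV. \<Sum>d\<in>UNIV. psi_up m b c d * nabla_chi a b c d)
             + 1 / 24 * (\<Sum>b\<in>UNIV. \<Sum>c\<in>UNIV. \<Sum>d\<in>UNIV. nabla_chi a b c d * star_chi_up m b c d))
          - 1 / 2 * (\<Sum>e\<in>UNIV. \<Sum>b\<in>UNIV. \<delta>\<Gamma> a e b * raise23 (g' \<kappa> x) (\<phi>' \<kappa> x) e m b)"
    unfolding Let_def sq R_def \<delta>_def N_def t_def t'_def up[unfolded \<psi>_def] \<psi>_def .
qed

end
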